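(* For any $\mu_1,\mu_2\in M_4(\mathbb{R})$ such that the Pauli diagonal maps $\Pi^{(2)}_{\mu_1},\Pi^{(2)}_{\mu_2}:\mathcal{M}_4\to\mathcal{M}_4$ are both completely positive and completely copositive, the composition $\Pi^{(2)}_{\mu_1}\circ\Pi^{(2)}_{\mu_2}$ is entanglement breaking.
   Context: Pauli matrices $\sigma_1=I_2$, $\sigma_2=\begin{pmatrix}0&1\\1&0\end{pmatrix}$, $\sigma_3=\begin{pmatrix}1&0\\0&-1\end{pmatrix}$, $\sigma_4=\begin{pmatrix}0&-i\\i&0\end{pmatrix}$; $\Pi^{(2)}_\mu(X)=\sum_{i,j}\frac{\mu_{ij}}4\mathrm{Tr}[(\sigma_i\otimes\sigma_j)X]\sigma_i\otimes\sigma_j$ on $\mathcal{M}_2\otimes\mathcal{M}_2\cong\mathcal{M}_4$. Completely copositive means $\vartheta\circ L$ is completely positive, $\vartheta$ the transpose. Entanglement breaking means the Choi matrix $(\mathrm{id}\otimes L)(|\Omega\rangle\langle\Omega|)$, $|\Omega\rangle=\sum_i|i\rangle\otimes|i\rangle$, is separable. *)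

theory Defs
  imports Complex_Main
begin

type_synonym 'i cmat = "'i \<Rightarrow> 'i \<Rightarrow> complex"

definition cnonneg :: "complex \<Rightarrow> bool" where
  "cnonneg z \<longleftrightarrow> Im z = 0 \<and> 0 \<le> Re z"

definition psd :: "('i::finite) cmat \<Rightarrow> bool" where
  "psd M \<longleftrightarrow> (\<forall>v :: 'i \<Rightarrow> complex. cnonneg (\<Sum>a\<in>UNIV. \<Sum>b\<in>UNIV. cnj (v a) * M a b * v b))"

definition psd_blocks :: "nat \<Rightarrow> (nat \<times> 'i::finite) cmat \<Rightarrow> bool" where
  "psd_blocks k X \<longleftrightarrow> (\<forall>v :: nat \<times> 'i \<Rightarrow> complex.
     cnonneg (\<Sum>p<k. \<Sum>q<k. \<Sum>a\<in>UNIV. \<Sum>b\<in>UNIV. cnj (v (p,a)) * X (p,a) (q,b) * v (q,b)))"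

definition ampl :: "('i cmat \<Rightarrow> 'j cmat) \<Rightarrow> (nat \<times> 'i) cmat \<Rightarrow> (nat \<times> 'j) cmat" where
  "ampl L X = (\<lambda>(p,a) (q,b). L (\<lambda>a' b'. X (p,a') (q,b')) a b)"

definition completely_positive :: "('i::finite cmat \<Rightarrow> 'j::finite cmat) \<Rightarrow> bool" where
  "completely_positive L \<longleftrightarrow> (\<forall>k X. psd_blocks k X \<longrightarrow> psd_blocks k (ampl L X))"

definition transp :: "'i cmat \<Rightarrow> 'i cmat" where
  "transp X = (\<lambda>a b. X b a)"

definition completely_copositive :: "('i::finite cmat \<Rightarrow> 'j::finite cmat) \<Rightarrow> bool" where
  "completely_copositive L \<longleftrightarrow> completely_positive (transp \<circ> L)"

definition kron :: "'i cmat \<Rightarrow> 'j cmat \<Rightarrow> ('i \<times> 'j) cmat" where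
  "kron A B = (\<lambda>(a,b) (c,d). A a c * B b d)"

definition trace :: "('i::finite) cmat \<Rightarrow> complex" where
  "trace A = (\<Sum>a\<in>UNIV. A a a)"

definition mmult :: "('i::finite) cmat \<Rightarrow> 'i cmat \<Rightarrow> 'i cmat" where
  "mmult A B = (\<lambda>a c. \<Sum>b\<in>UNIV. A a b * B b c)"

definition unitm :: "'i \<Rightarrow> 'i \<Rightarrow> 'i cmat" where
  "unitm a c = (\<lambda>x y. if x = a \<and> y = c then 1 else 0)"

text \<open>Choi matrix (id \<otimes> L)(|\<Omega>><\<Omega>|) with |\<Omega>> = \<Sum>_i |i>\<otimes>|i>.\<close>
definition choi :: "('i cmat \<Rightarrow> 'j cmat) \<Rightarrow> ('i \<times> 'j) cmat" where
  "choi L = (\<lambda>(a,b) (c,d). L (unitm a c) b d)"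

definition separable :: "('i::finite \<times> 'j::finite) cmat \<Rightarrow> bool" where
  "separable M \<longleftrightarrow> (\<exists>n (A :: nat \<Rightarrow> 'i cmat) (B :: nat \<Rightarrow> 'j cmat).
      (\<forall>k<n. psd (A k) \<and> psd (B k)) \<and> M = (\<lambda>x y. \<Sum>k<n. kron (A k) (B k) x y))"

definition entanglement_breaking :: "('i::finite cmat \<Rightarrow> 'j::finite cmat) \<Rightarrow> bool" where
  "entanglement_breaking L \<longleftrightarrow> separable (choi L)"

text \<open>Pauli matrices on C^2, basis |0> = False, |1> = True; sigma 1 = I,
  sigma 2 = X, sigma 3 = Z, sigma 4 = Y.\<close>
definition pauli :: "nat \<Rightarrow> bool cmat" where
  "pauli i = (\<lambda>a b.
     if i = 1 then (if a = b then 1 else 0)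
     else if i = 2 then (if a = b then 0 else 1)
     else if i = 3 then (if a = b then (if a then -1 else 1) else 0)
     else if i = 4 then (if a = b then 0 else if a then \<i> else - \<i>)
     else 0)"

definition pauli_diag2 :: "(nat \<Rightarrow> nat \<Rightarrow> real) \<Rightarrow> (bool \<times> bool) cmat \<Rightarrow> (bool \<times> bool) cmat" where
  "pauli_diag2 \<mu> X = (\<lambda>x y. \<Sum>i\<in>{1..4}. \<Sum>j\<in>{1..4}.
      complex_of_real (\<mu> i j / 4) * trace (mmult (kron (pauli i) (pauli j)) X)
        * kron (pauli i) (pauli j) x y)"

end

theory Submission
  imports Defs
begin

text \<open>
  For a Pauli diagonal map with multipliers \<open>\<mu>\<close>, the transform \<open>p = pauli_ft \<mu>\<close> lists the eigenvalues of the Choi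
  matrix, and the eigenvalues after transposition are \<open>p r s - (row r + column s) / 2 + total / 4\<close>.
  Both are nonnegative on a polyhedral cone in dimension 16 whose extremal rays are supported on
  permutations, on \<open>2 \<times> 2\<close> blocks, or on a row minus a point together with a partial permutation
  (or the transpose of this). Every nonzero point of the cone has one of these rays in its support, for both families
  of constraints, so the cone is generated by them. The first two kinds belong to
  maximal commuting sets of Pauli matrices and give entanglement breaking maps, because the Choi
  matrix is then a sum of products of joint eigenprojections. Composition multiplies the \<open>\<mu>\<close>; a commuting set
  absorbs any completely positive factor, and products of two rays of the last kind decompose explicitly into
  commuting sets.
\<close>

section \<open>Spectra and rays\<close>

text \<open>In dimension 4 by 4 a positive partial transpose does not imply separability in general,
  and the third kind of ray is what the commuting sets miss: its support contains neither a
  permutation nor a 2 by 2 block, so it is no nonnegative combination of the first two kinds. One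
  map alone may involve such rays; the second factor serves to remove them. The sign
  \<open>chr r i\<close> is 1 if the Pauli matrices \<open>r\<close> and \<open>i\<close> commute
  and -1 if they anticommute. It is the character table of the Klein four-group of Pauli matrices
  modulo phase. Thus \<open>pauli_ft\<close> is a Fourier transform on the square of this group, and
  translating a spectrum in the group multiplies the multipliers by a character. The set
  \<open>rays\<close> has 24 + 36 + 96 + 96 = 252 members. That a ray is not supported is a
  disjunction of sign conditions, so the existence of a supported ray is a question of linear
  arithmetic. With all rays and no order on the entries the case split would be huge; sorting the
  row and column potentials \<alpha> and \<beta> leaves few configurations, in each of which a small
  selection of rays already gives a contradiction.\<close>

definition chr :: "nat \<Rightarrow> nat \<Rightarrow> real" where
  "chr r i = (if r = 1 \<or> i = 1 \<or> r = i then 1 else -1)"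

definition pauli_ft :: "(nat \<Rightarrow> nat \<Rightarrow> real) \<Rightarrow> nat \<Rightarrow> nat \<Rightarrow> real" where
  "pauli_ft \<mu> r s = (\<Sum>i\<in>{1..4}. \<Sum>j\<in>{1..4}. chr r i * chr s j * \<mu> i j)"

text \<open>
  If \<open>p = pauli_ft \<mu>\<close> is the (rescaled) spectrum of the Choi matrix, then \<open>slack p\<close> is, up to reordering,
  the spectrum of its partial transpose.
\<close>

definition slack :: "(nat \<Rightarrow> nat \<Rightarrow> real) \<Rightarrow> nat \<Rightarrow> nat \<Rightarrow> real" where
  "slack p r s = p r s - ((\<Sum>j\<in>{1..4}. p r j) + (\<Sum>i\<in>{1..4}. p i s)) / 2
     + (\<Sum>i\<in>{1..4}. \<Sum>j\<in>{1..4}. p i j) / 4"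

definition ppt :: "(nat \<Rightarrow> nat \<Rightarrow> real) \<Rightarrow> bool" where
  "ppt p \<longleftrightarrow> (\<forall>r\<in>{1..4}. \<forall>s\<in>{1..4}. 0 \<le> p r s \<and> 0 \<le> slack p r s)"

lemma sum_idx: "(\<Sum>i\<in>{1..4::nat}. f i) = f 1 + f 2 + f 3 + (f 4 :: 'a::comm_monoid_add)"
proof -
  have "{1..4::nat} = {1,2,3,4}" by auto
  then show ?thesis by (simp add: add.assoc)
qed

text \<open>The equation \<open>{a,b,c,d} = {1..4}\<close> is how an arrangement of the four indices
  is written throughout. Four names that exhaust four elements are distinct by cardinality.\<close>

lemma enum_distinct:
  assumes "{a,b,c,d} = {1..4::nat}"
  shows "a \<noteq> b" "a \<noteq> c" "a \<noteq> d" "b \<noteq> c" "b \<noteq> d" "c \<noteq> d"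
proof -
  have "card (set [a,b,c,d]) = length [a,b,c,d]" using assms by simp
  then have "distinct [a,b,c,d]" by (rule card_distinct)
  then show "a \<noteq> b" "a \<noteq> c" "a \<noteq> d" "b \<noteq> c" "b \<noteq> d" "c \<noteq> d" by simp_all
qed

lemma sum_enum:
  assumes "{a,b,c,d} = {1..4::nat}"
  shows "(\<Sum>i\<in>{1..4}. f i) = f a + f b + f c + (f d :: 'a::comm_monoid_add)"
  unfolding assms[symmetric] using enum_distinct[OF assms] by (simp add: add.assoc)

lemma enum_sorted:
  fixes f :: "nat \<Rightarrow> real"
  obtains a b c d where "{a,b,c,d} = {1..4}" "f a \<ge> f b" "f b \<ge> f c" "f c \<ge> f d"
proof -
  define xs where "xs = sort_key (\<lambda>i. - f i) [1,2,3,4]"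
  have "length xs = 4" by (simp add: xs_def)
  then have "length xs = Suc (Suc (Suc (Suc 0)))" by simp
  then obtain a b c d where xs: "xs = [a,b,c,d]" unfolding length_Suc_conv by blast
  have "set xs = {1,2,3,4}" unfolding xs_def set_sort by simp
  also have "\<dots> = {1..4}" by auto
  finally have "{a,b,c,d} = {1..4}" using xs by simp
  moreover have "sorted (map (\<lambda>i. - f i) xs)" unfolding xs_def by (rule sorted_sort_key)
  then have "f a \<ge> f b" "f b \<ge> f c" "f c \<ge> f d" unfolding xs by simp_all
  ultimately show thesis using that by blast
qed

text \<open>
  A ray is recorded by the pair \<open>(S, T)\<close> of the supports of its two constraint matrices \<open>p\<close> and
  \<open>slack p\<close>, both of which are indicator functions. Those of shape \<open>perm\<close> and \<open>block\<close> come from maximal commuting sets of Pauli matrices.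
\<close>

inductive_set rays :: "((nat \<times> nat) set \<times> (nat \<times> nat) set) set" where
  perm: "{a,b,c,d} = {1..4} \<Longrightarrow> {a',b',c',d'} = {1..4} \<Longrightarrow>
    ({(a,a'),(b,b'),(c,c'),(d,d')}, {(a,a'),(b,b'),(c,c'),(d,d')}) \<in> rays"
| block: "{a,b,c,d} = {1..4} \<Longrightarrow> {a',b',c',d'} = {1..4} \<Longrightarrow>
    ({(a,a'),(a,b'),(b,a'),(b,b')}, {(c,c'),(c,d'),(d,c'),(d,d')}) \<in> rays"
| row: "{a,b,c,d} = {1..4} \<Longrightarrow> {a',b',c',d'} = {1..4} \<Longrightarrow>
    ({(a,b'),(a,c'),(a,d'),(b,b'),(c,c'),(d,d')}, {(b,a'),(c,a'),(d,a'),(b,b'),(c,c'),(d,d')}) \<in> rays"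
| col: "{a,b,c,d} = {1..4} \<Longrightarrow> {a',b',c',d'} = {1..4} \<Longrightarrow>
    ({(b,a'),(c,a'),(d,a'),(b,b'),(c,c'),(d,d')}, {(a,b'),(a,c'),(a,d'),(b,b'),(c,c'),(d,d')}) \<in> rays"

text \<open>Strict positivity on both supports is what allows a small positive multiple of the ray
  to be subtracted without violating either family of inequalities.\<close>

definition supports :: "(nat \<Rightarrow> nat \<Rightarrow> real) \<Rightarrow> (nat \<Rightarrow> nat \<Rightarrow> real) \<Rightarrow> bool" where
  "supports P Q \<longleftrightarrow> (\<exists>(S,T)\<in>rays. (\<forall>(i,j)\<in>S. 0 < P i j) \<and> (\<forall>(i,j)\<in>T. 0 < Q i j))"

text \<open>This reflects that \<open>slack\<close> is an involution. Permutations are fixed, a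
  block goes to the complementary block, and the shapes \<open>row\<close> and \<open>col\<close>
  are exchanged.\<close>

lemma rays_swap: "(S, T) \<in> rays \<Longrightarrow> (T, S) \<in> rays"
proof (induction S T rule: rays.induct)
  case (perm a b c d a' b' c' d') then show ?case by (rule rays.perm)
next
  case (block a b c d a' b' c' d')
  then have "{c,d,a,b} = {1..4}" "{c',d',a',b'} = {1..4}" by auto
  then show ?case by (rule rays.block)
next
  case (row a b c d a' b' c' d') then show ?case by (rule rays.col)
next
  case (col a b c d a' b' c' d') then show ?case by (rule rays.row)
qed

lemma rays_transpose: "(S, T) \<in> rays \<Longrightarrow> (prod.swap ` S, prod.swap ` T) \<in> rays"
proof (induction S T rule: rays.induct)
  case (perm a b c d a' b' c' d')
  from rays.perm[OF perm(2,1)] show ?case by simp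
next
  case (block a b c d a' b' c' d')
  from rays.block[OF block(2,1)] show ?case by (simp add: insert_commute)
next
  case (row a b c d a' b' c' d')
  from rays.col[OF row(2,1)] show ?case by simp
next
  case (col a b c d a' b' c' d')
  from rays.row[OF col(2,1)] show ?case by simp
qed

lemma supports_swap: "supports P Q \<Longrightarrow> supports Q P"
  unfolding supports_def by (elim bexE, rename_tac x, rule_tac x = "prod.swap x" in bexI)
    (auto intro: rays_swap)

lemma supports_transpose: "supports (\<lambda>i j. P j i) (\<lambda>i j. Q j i) \<Longrightarrow> supports P Q"
  unfolding supports_def
  by (elim bexE, rename_tac x, rule_tac x = "map_prod ((`) prod.swap) ((`) prod.swap) x" in bexI)
    (auto simp: split_beta dest: rays_transpose)

section \<open>Supported rays\<close>

text \<open>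
  In the next two lemmas \<open>p\<close> and \<open>q\<close> stand for a pair of constraint matrices
  with \<open>p - q\<close> of the form \<open>a i - b j\<close>; the disjunctions say that particular rays are not supported,
  a selection of rays that suffices for a contradiction.
\<close>

lemma supports_ray_strict:
  fixes p00 q00 p01 q01 p02 q02 p03 q03
    p10 q10 p11 q11 p12 q12 p13 q13
    p20 q20 p21 q21 p22 q22 p23 q23
    p30 q30 p31 q31 p32 q32 p33 q33
    a0 a1 a2 a3 b0 b1 b2 b3 :: real
  assumes "p00 \<ge> 0" "q00 \<ge> 0" "p01 \<ge> 0" "q01 \<ge> 0" "p02 \<ge> 0" "q02 \<ge> 0" "p03 \<ge> 0" "q03 \<ge> 0" "p10 \<ge> 0" "q10 \<ge> 0" "p11 \<ge> 0" "q11 \<ge> 0" "p12 \<ge> 0" "q12 \<ge> 0" "p13 \<ge> 0" "q13 \<ge> 0" "p20 \<ge> 0" "q20 \<ge> 0" "p21 \<ge> 0" "q21 \<ge> 0" "p22 \<ge> 0" "q22 \<ge> 0" "p23 \<ge> 0" "q23 \<ge> 0" "p30 \<ge> 0" "q30 \<ge> 0" "p31 \<ge> 0" "q31 \<ge> 0" "p32 \<ge> 0" "q32 \<ge> 0" "p33 \<ge> 0" "q33 \<ge> 0"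
    and "p00 - q00 = a0 - b0" "p01 - q01 = a0 - b1" "p02 - q02 = a0 - b2" "p03 - q03 = a0 - b3"
    "p10 - q10 = a1 - b0" "p11 - q11 = a1 - b1" "p12 - q12 = a1 - b2" "p13 - q13 = a1 - b3"
    "p20 - q20 = a2 - b0" "p21 - q21 = a2 - b1" "p22 - q22 = a2 - b2" "p23 - q23 = a2 - b3"
    "p30 - q30 = a3 - b0" "p31 - q31 = a3 - b1" "p32 - q32 = a3 - b2" "p33 - q33 = a3 - b3"
    and "p00 + q00 + p01 + q01 + p02 + q02 + p03 + q03 = 1"
    "p10 + q10 + p11 + q11 + p12 + q12 + p13 + q13 = 1"
    "p20 + q20 + p21 + q21 + p22 + q22 + p23 + q23 = 1"
    "p30 + q30 + p31 + q31 + p32 + q32 + p33 + q33 = 1"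
    and "p00 + q00 + p10 + q10 + p20 + q20 + p30 + q30 = 1"
    "p01 + q01 + p11 + q11 + p21 + q21 + p31 + q31 = 1"
    "p02 + q02 + p12 + q12 + p22 + q22 + p32 + q32 = 1"
    "p03 + q03 + p13 + q13 + p23 + q23 + p33 + q33 = 1"
    and "a0 + a1 + a2 + a3 = 0" "b0 + b1 + b2 + b3 = 0"
    and "a0 \<ge> b1" "a0 \<ge> b2" "a0 \<ge> b3" "a1 \<ge> b1" "a1 \<ge> b2" "a1 \<ge> b3" "a2 \<ge> b1" "a2 \<ge> b2" "a2 \<ge> b3"
    and "p01 > 0" "p02 > 0" "p03 > 0" "p11 > 0" "p12 > 0" "p13 > 0" "p21 > 0" "p22 > 0" "p23 > 0"
    and "p00 \<le> 0 \<or> p12 \<le> 0 \<or> p21 \<le> 0 \<or> p33 \<le> 0 \<or> q00 \<le> 0 \<or> q12 \<le> 0 \<or> q21 \<le> 0 \<or> q33 \<le> 0"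
    "p00 \<le> 0 \<or> p13 \<le> 0 \<or> p21 \<le> 0 \<or> p32 \<le> 0 \<or> q00 \<le> 0 \<or> q13 \<le> 0 \<or> q21 \<le> 0 \<or> q32 \<le> 0"
    "p01 \<le> 0 \<or> p10 \<le> 0 \<or> p22 \<le> 0 \<or> p33 \<le> 0 \<or> q01 \<le> 0 \<or> q10 \<le> 0 \<or> q22 \<le> 0 \<or> q33 \<le> 0"
    "p03 \<le> 0 \<or> p11 \<le> 0 \<or> p22 \<le> 0 \<or> p30 \<le> 0 \<or> q03 \<le> 0 \<or> q11 \<le> 0 \<or> q22 \<le> 0 \<or> q30 \<le> 0"
    "p00 \<le> 0 \<or> p01 \<le> 0 \<or> p20 \<le> 0 \<or> p21 \<le> 0 \<or> q12 \<le> 0 \<or> q13 \<le> 0 \<or> q32 \<le> 0 \<or> q33 \<le> 0"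
    "p01 \<le> 0 \<or> p02 \<le> 0 \<or> p21 \<le> 0 \<or> p22 \<le> 0 \<or> q10 \<le> 0 \<or> q13 \<le> 0 \<or> q30 \<le> 0 \<or> q33 \<le> 0"
    "p01 \<le> 0 \<or> p03 \<le> 0 \<or> p21 \<le> 0 \<or> p23 \<le> 0 \<or> q10 \<le> 0 \<or> q12 \<le> 0 \<or> q30 \<le> 0 \<or> q32 \<le> 0"
    "p02 \<le> 0 \<or> p03 \<le> 0 \<or> p22 \<le> 0 \<or> p23 \<le> 0 \<or> q10 \<le> 0 \<or> q11 \<le> 0 \<or> q30 \<le> 0 \<or> q31 \<le> 0"
    "p01 \<le> 0 \<or> p02 \<le> 0 \<or> p31 \<le> 0 \<or> p32 \<le> 0 \<or> q10 \<le> 0 \<or> q13 \<le> 0 \<or> q20 \<le> 0 \<or> q23 \<le> 0"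
    "p10 \<le> 0 \<or> p12 \<le> 0 \<or> p20 \<le> 0 \<or> p22 \<le> 0 \<or> q01 \<le> 0 \<or> q03 \<le> 0 \<or> q31 \<le> 0 \<or> q33 \<le> 0"
    "p11 \<le> 0 \<or> p12 \<le> 0 \<or> p21 \<le> 0 \<or> p22 \<le> 0 \<or> q00 \<le> 0 \<or> q03 \<le> 0 \<or> q30 \<le> 0 \<or> q33 \<le> 0"
    "p11 \<le> 0 \<or> p13 \<le> 0 \<or> p21 \<le> 0 \<or> p23 \<le> 0 \<or> q00 \<le> 0 \<or> q02 \<le> 0 \<or> q30 \<le> 0 \<or> q32 \<le> 0"
    "p02 \<le> 0 \<or> p03 \<le> 0 \<or> p01 \<le> 0 \<or> p12 \<le> 0 \<or> p23 \<le> 0 \<or> p31 \<le> 0 \<or> q10 \<le> 0 \<or> q20 \<le> 0 \<or> q30 \<le> 0 \<or> q12 \<le> 0 \<or> q23 \<le> 0 \<or> q31 \<le> 0"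
    "p03 \<le> 0 \<or> p01 \<le> 0 \<or> p02 \<le> 0 \<or> p13 \<le> 0 \<or> p21 \<le> 0 \<or> p32 \<le> 0 \<or> q10 \<le> 0 \<or> q20 \<le> 0 \<or> q30 \<le> 0 \<or> q13 \<le> 0 \<or> q21 \<le> 0 \<or> q32 \<le> 0"
    "p03 \<le> 0 \<or> p02 \<le> 0 \<or> p01 \<le> 0 \<or> p13 \<le> 0 \<or> p22 \<le> 0 \<or> p31 \<le> 0 \<or> q10 \<le> 0 \<or> q20 \<le> 0 \<or> q30 \<le> 0 \<or> q13 \<le> 0 \<or> q22 \<le> 0 \<or> q31 \<le> 0"
    "p11 \<le> 0 \<or> p21 \<le> 0 \<or> p31 \<le> 0 \<or> p12 \<le> 0 \<or> p23 \<le> 0 \<or> p30 \<le> 0 \<or> q02 \<le> 0 \<or> q03 \<le> 0 \<or> q00 \<le> 0 \<or> q12 \<le> 0 \<or> q23 \<le> 0 \<or> q30 \<le> 0"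
    "p11 \<le> 0 \<or> p13 \<le> 0 \<or> p12 \<le> 0 \<or> p01 \<le> 0 \<or> p23 \<le> 0 \<or> p32 \<le> 0 \<or> q00 \<le> 0 \<or> q20 \<le> 0 \<or> q30 \<le> 0 \<or> q01 \<le> 0 \<or> q23 \<le> 0 \<or> q32 \<le> 0"
    "p21 \<le> 0 \<or> p22 \<le> 0 \<or> p23 \<le> 0 \<or> p01 \<le> 0 \<or> p12 \<le> 0 \<or> p33 \<le> 0 \<or> q00 \<le> 0 \<or> q10 \<le> 0 \<or> q30 \<le> 0 \<or> q01 \<le> 0 \<or> q12 \<le> 0 \<or> q33 \<le> 0"
    "p22 \<le> 0 \<or> p21 \<le> 0 \<or> p23 \<le> 0 \<or> p02 \<le> 0 \<or> p11 \<le> 0 \<or> p33 \<le> 0 \<or> q00 \<le> 0 \<or> q10 \<le> 0 \<or> q30 \<le> 0 \<or> q02 \<le> 0 \<or> q11 \<le> 0 \<or> q33 \<le> 0"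
    "p23 \<le> 0 \<or> p21 \<le> 0 \<or> p22 \<le> 0 \<or> p03 \<le> 0 \<or> p11 \<le> 0 \<or> p32 \<le> 0 \<or> q00 \<le> 0 \<or> q10 \<le> 0 \<or> q30 \<le> 0 \<or> q03 \<le> 0 \<or> q11 \<le> 0 \<or> q32 \<le> 0"
    "p23 \<le> 0 \<or> p22 \<le> 0 \<or> p21 \<le> 0 \<or> p03 \<le> 0 \<or> p12 \<le> 0 \<or> p31 \<le> 0 \<or> q00 \<le> 0 \<or> q10 \<le> 0 \<or> q30 \<le> 0 \<or> q03 \<le> 0 \<or> q12 \<le> 0 \<or> q31 \<le> 0"
    "p01 \<le> 0 \<or> p11 \<le> 0 \<or> p31 \<le> 0 \<or> p02 \<le> 0 \<or> p13 \<le> 0 \<or> p30 \<le> 0 \<or> q22 \<le> 0 \<or> q23 \<le> 0 \<or> q20 \<le> 0 \<or> q02 \<le> 0 \<or> q13 \<le> 0 \<or> q30 \<le> 0"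
    "p21 \<le> 0 \<or> p23 \<le> 0 \<or> p20 \<le> 0 \<or> p01 \<le> 0 \<or> p13 \<le> 0 \<or> p30 \<le> 0 \<or> q02 \<le> 0 \<or> q12 \<le> 0 \<or> q32 \<le> 0 \<or> q01 \<le> 0 \<or> q13 \<le> 0 \<or> q30 \<le> 0"
    "p01 \<le> 0 \<or> p11 \<le> 0 \<or> p21 \<le> 0 \<or> p00 \<le> 0 \<or> p12 \<le> 0 \<or> p23 \<le> 0 \<or> q30 \<le> 0 \<or> q32 \<le> 0 \<or> q33 \<le> 0 \<or> q00 \<le> 0 \<or> q12 \<le> 0 \<or> q23 \<le> 0"
    "p01 \<le> 0 \<or> p11 \<le> 0 \<or> p21 \<le> 0 \<or> p00 \<le> 0 \<or> p13 \<le> 0 \<or> p22 \<le> 0 \<or> q30 \<le> 0 \<or> q33 \<le> 0 \<or> q32 \<le> 0 \<or> q00 \<le> 0 \<or> q13 \<le> 0 \<or> q22 \<le> 0"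
    "p01 \<le> 0 \<or> p11 \<le> 0 \<or> p21 \<le> 0 \<or> p02 \<le> 0 \<or> p13 \<le> 0 \<or> p20 \<le> 0 \<or> q32 \<le> 0 \<or> q33 \<le> 0 \<or> q30 \<le> 0 \<or> q02 \<le> 0 \<or> q13 \<le> 0 \<or> q20 \<le> 0"
    "p01 \<le> 0 \<or> p11 \<le> 0 \<or> p21 \<le> 0 \<or> p03 \<le> 0 \<or> p12 \<le> 0 \<or> p20 \<le> 0 \<or> q33 \<le> 0 \<or> q32 \<le> 0 \<or> q30 \<le> 0 \<or> q03 \<le> 0 \<or> q12 \<le> 0 \<or> q20 \<le> 0"
    "p02 \<le> 0 \<or> p12 \<le> 0 \<or> p22 \<le> 0 \<or> p01 \<le> 0 \<or> p10 \<le> 0 \<or> p23 \<le> 0 \<or> q31 \<le> 0 \<or> q30 \<le> 0 \<or> q33 \<le> 0 \<or> q01 \<le> 0 \<or> q10 \<le> 0 \<or> q23 \<le> 0"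
    "p02 \<le> 0 \<or> p12 \<le> 0 \<or> p22 \<le> 0 \<or> p03 \<le> 0 \<or> p10 \<le> 0 \<or> p21 \<le> 0 \<or> q33 \<le> 0 \<or> q30 \<le> 0 \<or> q31 \<le> 0 \<or> q03 \<le> 0 \<or> q10 \<le> 0 \<or> q21 \<le> 0"
    "p02 \<le> 0 \<or> p12 \<le> 0 \<or> p22 \<le> 0 \<or> p03 \<le> 0 \<or> p11 \<le> 0 \<or> p20 \<le> 0 \<or> q33 \<le> 0 \<or> q31 \<le> 0 \<or> q30 \<le> 0 \<or> q03 \<le> 0 \<or> q11 \<le> 0 \<or> q20 \<le> 0"
  shows False
  using assms by (smt (z3))

lemma supports_ray_degenerate:
  fixes p00 q00 p01 q01 p02 q02 p03 q03
    p10 q10 p11 q11 p12 q12 p13 q13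
    p20 q20 p21 q21 p22 q22 p23 q23
    p30 q30 p31 q31 p32 q32 p33 q33
    a0 a1 a2 a3 b0 b1 b2 b3 :: real
  assumes "p00 \<ge> 0" "q00 \<ge> 0" "p01 \<ge> 0" "q01 \<ge> 0" "p02 \<ge> 0" "q02 \<ge> 0" "p03 \<ge> 0" "q03 \<ge> 0" "p10 \<ge> 0" "q10 \<ge> 0" "p11 \<ge> 0" "q11 \<ge> 0" "p12 \<ge> 0" "q12 \<ge> 0" "p13 \<ge> 0" "q13 \<ge> 0" "p20 \<ge> 0" "q20 \<ge> 0" "p21 \<ge> 0" "q21 \<ge> 0" "p22 \<ge> 0" "q22 \<ge> 0" "p23 \<ge> 0" "q23 \<ge> 0" "p30 \<ge> 0" "q30 \<ge> 0" "p31 \<ge> 0" "q31 \<ge> 0" "p32 \<ge> 0" "q32 \<ge> 0" "p33 \<ge> 0" "q33 \<ge> 0"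
    and "p00 - q00 = a0 - b0" "p01 - q01 = a0 - b1" "p02 - q02 = a0 - b2" "p03 - q03 = a0 - b3"
    "p10 - q10 = a1 - b0" "p11 - q11 = a1 - b1" "p12 - q12 = a1 - b2" "p13 - q13 = a1 - b3"
    "p20 - q20 = a2 - b0" "p21 - q21 = a2 - b1" "p22 - q22 = a2 - b2" "p23 - q23 = a2 - b3"
    "p30 - q30 = a3 - b0" "p31 - q31 = a3 - b1" "p32 - q32 = a3 - b2" "p33 - q33 = a3 - b3"
    and "p00 + q00 + p01 + q01 + p02 + q02 + p03 + q03 = 1"
    "p10 + q10 + p11 + q11 + p12 + q12 + p13 + q13 = 1"
    "p20 + q20 + p21 + q21 + p22 + q22 + p23 + q23 = 1"
    "p30 + q30 + p31 + q31 + p32 + q32 + p33 + q33 = 1"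
    and "p00 + q00 + p10 + q10 + p20 + q20 + p30 + q30 = 1"
    "p01 + q01 + p11 + q11 + p21 + q21 + p31 + q31 = 1"
    "p02 + q02 + p12 + q12 + p22 + q22 + p32 + q32 = 1"
    "p03 + q03 + p13 + q13 + p23 + q23 + p33 + q33 = 1"
    and "a0 + a1 + a2 + a3 = 0" "b0 + b1 + b2 + b3 = 0"
    and "a0 \<ge> b1" "a0 \<ge> b2" "a0 \<ge> b3" "a1 \<ge> b1" "a1 \<ge> b2" "a1 \<ge> b3" "a2 \<ge> b1" "a2 \<ge> b2" "a2 \<ge> b3"
    and "p21 = 0" "b0 > a2" "a0 \<ge> a1" "b2 \<ge> b3"
    and "p01 \<le> 0 \<or> p03 \<le> 0 \<or> p11 \<le> 0 \<or> p13 \<le> 0 \<or> q20 \<le> 0 \<or> q22 \<le> 0 \<or> q30 \<le> 0 \<or> q32 \<le> 0"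
    "p02 \<le> 0 \<or> p03 \<le> 0 \<or> p22 \<le> 0 \<or> p23 \<le> 0 \<or> q10 \<le> 0 \<or> q11 \<le> 0 \<or> q30 \<le> 0 \<or> q31 \<le> 0"
    "p01 \<le> 0 \<or> p03 \<le> 0 \<or> p31 \<le> 0 \<or> p33 \<le> 0 \<or> q10 \<le> 0 \<or> q12 \<le> 0 \<or> q20 \<le> 0 \<or> q22 \<le> 0"
    "p01 \<le> 0 \<or> p02 \<le> 0 \<or> p03 \<le> 0 \<or> p11 \<le> 0 \<or> p22 \<le> 0 \<or> p33 \<le> 0 \<or> q10 \<le> 0 \<or> q20 \<le> 0 \<or> q30 \<le> 0 \<or> q11 \<le> 0 \<or> q22 \<le> 0 \<or> q33 \<le> 0"
    "p01 \<le> 0 \<or> p03 \<le> 0 \<or> p02 \<le> 0 \<or> p11 \<le> 0 \<or> p23 \<le> 0 \<or> p32 \<le> 0 \<or> q10 \<le> 0 \<or> q20 \<le> 0 \<or> q30 \<le> 0 \<or> q11 \<le> 0 \<or> q23 \<le> 0 \<or> q32 \<le> 0"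
    "p02 \<le> 0 \<or> p03 \<le> 0 \<or> p01 \<le> 0 \<or> p12 \<le> 0 \<or> p23 \<le> 0 \<or> p31 \<le> 0 \<or> q10 \<le> 0 \<or> q20 \<le> 0 \<or> q30 \<le> 0 \<or> q12 \<le> 0 \<or> q23 \<le> 0 \<or> q31 \<le> 0"
    "p03 \<le> 0 \<or> p02 \<le> 0 \<or> p01 \<le> 0 \<or> p13 \<le> 0 \<or> p22 \<le> 0 \<or> p31 \<le> 0 \<or> q10 \<le> 0 \<or> q20 \<le> 0 \<or> q30 \<le> 0 \<or> q13 \<le> 0 \<or> q22 \<le> 0 \<or> q31 \<le> 0"
    "p11 \<le> 0 \<or> p12 \<le> 0 \<or> p13 \<le> 0 \<or> p01 \<le> 0 \<or> p22 \<le> 0 \<or> p33 \<le> 0 \<or> q00 \<le> 0 \<or> q20 \<le> 0 \<or> q30 \<le> 0 \<or> q01 \<le> 0 \<or> q22 \<le> 0 \<or> q33 \<le> 0"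
    "p03 \<le> 0 \<or> p23 \<le> 0 \<or> p33 \<le> 0 \<or> p00 \<le> 0 \<or> p22 \<le> 0 \<or> p31 \<le> 0 \<or> q10 \<le> 0 \<or> q12 \<le> 0 \<or> q11 \<le> 0 \<or> q00 \<le> 0 \<or> q22 \<le> 0 \<or> q31 \<le> 0"
    "p03 \<le> 0 \<or> p23 \<le> 0 \<or> p33 \<le> 0 \<or> p01 \<le> 0 \<or> p20 \<le> 0 \<or> p32 \<le> 0 \<or> q11 \<le> 0 \<or> q10 \<le> 0 \<or> q12 \<le> 0 \<or> q01 \<le> 0 \<or> q20 \<le> 0 \<or> q32 \<le> 0"
    "p03 \<le> 0 \<or> p23 \<le> 0 \<or> p33 \<le> 0 \<or> p02 \<le> 0 \<or> p20 \<le> 0 \<or> p31 \<le> 0 \<or> q12 \<le> 0 \<or> q10 \<le> 0 \<or> q11 \<le> 0 \<or> q02 \<le> 0 \<or> q20 \<le> 0 \<or> q31 \<le> 0"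
    "p31 \<le> 0 \<or> p32 \<le> 0 \<or> p33 \<le> 0 \<or> p01 \<le> 0 \<or> p12 \<le> 0 \<or> p23 \<le> 0 \<or> q00 \<le> 0 \<or> q10 \<le> 0 \<or> q20 \<le> 0 \<or> q01 \<le> 0 \<or> q12 \<le> 0 \<or> q23 \<le> 0"
    "p31 \<le> 0 \<or> p33 \<le> 0 \<or> p32 \<le> 0 \<or> p01 \<le> 0 \<or> p13 \<le> 0 \<or> p22 \<le> 0 \<or> q00 \<le> 0 \<or> q10 \<le> 0 \<or> q20 \<le> 0 \<or> q01 \<le> 0 \<or> q13 \<le> 0 \<or> q22 \<le> 0"
    "p32 \<le> 0 \<or> p31 \<le> 0 \<or> p33 \<le> 0 \<or> p02 \<le> 0 \<or> p11 \<le> 0 \<or> p23 \<le> 0 \<or> q00 \<le> 0 \<or> q10 \<le> 0 \<or> q20 \<le> 0 \<or> q02 \<le> 0 \<or> q11 \<le> 0 \<or> q23 \<le> 0"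
    "p33 \<le> 0 \<or> p31 \<le> 0 \<or> p32 \<le> 0 \<or> p03 \<le> 0 \<or> p11 \<le> 0 \<or> p22 \<le> 0 \<or> q00 \<le> 0 \<or> q10 \<le> 0 \<or> q20 \<le> 0 \<or> q03 \<le> 0 \<or> q11 \<le> 0 \<or> q22 \<le> 0"
    "p03 \<le> 0 \<or> p13 \<le> 0 \<or> p23 \<le> 0 \<or> p01 \<le> 0 \<or> p12 \<le> 0 \<or> p20 \<le> 0 \<or> q31 \<le> 0 \<or> q32 \<le> 0 \<or> q30 \<le> 0 \<or> q01 \<le> 0 \<or> q12 \<le> 0 \<or> q20 \<le> 0"
    "p03 \<le> 0 \<or> p13 \<le> 0 \<or> p23 \<le> 0 \<or> p02 \<le> 0 \<or> p11 \<le> 0 \<or> p20 \<le> 0 \<or> q32 \<le> 0 \<or> q31 \<le> 0 \<or> q30 \<le> 0 \<or> q02 \<le> 0 \<or> q11 \<le> 0 \<or> q20 \<le> 0"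
  shows False
  using assms by (smt (z3))

text \<open>Birkhoff's argument: the support of a nonnegative matrix with equal positive line sums
  contains a permutation. The disjunctions exclude all 24 permutations of four indices.\<close>

lemma supports_perm:
  fixes p00 p01 p02 p03 p10 p11 p12 p13 p20 p21 p22 p23 p30 p31 p32 p33 s :: real
  assumes "p00 \<ge> 0" "p01 \<ge> 0" "p02 \<ge> 0" "p03 \<ge> 0" "p10 \<ge> 0" "p11 \<ge> 0" "p12 \<ge> 0" "p13 \<ge> 0" "p20 \<ge> 0" "p21 \<ge> 0" "p22 \<ge> 0" "p23 \<ge> 0" "p30 \<ge> 0" "p31 \<ge> 0" "p32 \<ge> 0" "p33 \<ge> 0"
    and "p00 + p01 + p02 + p03 = s"
    "p10 + p11 + p12 + p13 = s"
    "p20 + p21 + p22 + p23 = s"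
    "p30 + p31 + p32 + p33 = s"
    and "p00 + p10 + p20 + p30 = s"
    "p01 + p11 + p21 + p31 = s"
    "p02 + p12 + p22 + p32 = s"
    "p03 + p13 + p23 + p33 = s"
    and "p00 \<le> 0 \<or> p11 \<le> 0 \<or> p22 \<le> 0 \<or> p33 \<le> 0"
    "p00 \<le> 0 \<or> p11 \<le> 0 \<or> p23 \<le> 0 \<or> p32 \<le> 0"
    "p00 \<le> 0 \<or> p12 \<le> 0 \<or> p21 \<le> 0 \<or> p33 \<le> 0"
    "p00 \<le> 0 \<or> p12 \<le> 0 \<or> p23 \<le> 0 \<or> p31 \<le> 0"
    "p00 \<le> 0 \<or> p13 \<le> 0 \<or> p21 \<le> 0 \<or> p32 \<le> 0"
    "p00 \<le> 0 \<or> p13 \<le> 0 \<or> p22 \<le> 0 \<or> p31 \<le> 0"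
    "p01 \<le> 0 \<or> p10 \<le> 0 \<or> p22 \<le> 0 \<or> p33 \<le> 0"
    "p01 \<le> 0 \<or> p10 \<le> 0 \<or> p23 \<le> 0 \<or> p32 \<le> 0"
    "p01 \<le> 0 \<or> p12 \<le> 0 \<or> p20 \<le> 0 \<or> p33 \<le> 0"
    "p01 \<le> 0 \<or> p12 \<le> 0 \<or> p23 \<le> 0 \<or> p30 \<le> 0"
    "p01 \<le> 0 \<or> p13 \<le> 0 \<or> p20 \<le> 0 \<or> p32 \<le> 0"
    "p01 \<le> 0 \<or> p13 \<le> 0 \<or> p22 \<le> 0 \<or> p30 \<le> 0"
    "p02 \<le> 0 \<or> p10 \<le> 0 \<or> p21 \<le> 0 \<or> p33 \<le> 0"
    "p02 \<le> 0 \<or> p10 \<le> 0 \<or> p23 \<le> 0 \<or> p31 \<le> 0"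
    "p02 \<le> 0 \<or> p11 \<le> 0 \<or> p20 \<le> 0 \<or> p33 \<le> 0"
    "p02 \<le> 0 \<or> p11 \<le> 0 \<or> p23 \<le> 0 \<or> p30 \<le> 0"
    "p02 \<le> 0 \<or> p13 \<le> 0 \<or> p20 \<le> 0 \<or> p31 \<le> 0"
    "p02 \<le> 0 \<or> p13 \<le> 0 \<or> p21 \<le> 0 \<or> p30 \<le> 0"
    "p03 \<le> 0 \<or> p10 \<le> 0 \<or> p21 \<le> 0 \<or> p32 \<le> 0"
    "p03 \<le> 0 \<or> p10 \<le> 0 \<or> p22 \<le> 0 \<or> p31 \<le> 0"
    "p03 \<le> 0 \<or> p11 \<le> 0 \<or> p20 \<le> 0 \<or> p32 \<le> 0"
    "p03 \<le> 0 \<or> p11 \<le> 0 \<or> p22 \<le> 0 \<or> p30 \<le> 0"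
    "p03 \<le> 0 \<or> p12 \<le> 0 \<or> p20 \<le> 0 \<or> p31 \<le> 0"
    "p03 \<le> 0 \<or> p12 \<le> 0 \<or> p21 \<le> 0 \<or> p30 \<le> 0"
    and "s > 0"
  shows False
  using assms by (smt (z3))

text \<open>Modulo normalisation, \<open>balanced\<close> characterises the pairs \<open>(p, slack p)\<close> with \<open>ppt p\<close>.\<close>

definition balanced :: "(nat \<Rightarrow> nat \<Rightarrow> real) \<Rightarrow> (nat \<Rightarrow> nat \<Rightarrow> real) \<Rightarrow> (nat \<Rightarrow> real) \<Rightarrow> (nat \<Rightarrow> real) \<Rightarrow> bool" where
  "balanced P Q \<alpha> \<beta> \<longleftrightarrow>
    (\<forall>i\<in>{1..4}. \<forall>j\<in>{1..4}. 0 \<le> P i j \<and> 0 \<le> Q i j \<and> P i j - Q i j = \<alpha> i - \<beta> j) \<and>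
    (\<forall>i\<in>{1..4}. (\<Sum>j\<in>{1..4}. P i j + Q i j) = 1) \<and>
    (\<forall>j\<in>{1..4}. (\<Sum>i\<in>{1..4}. P i j + Q i j) = 1) \<and>
    (\<Sum>i\<in>{1..4}. \<alpha> i) = 0 \<and> (\<Sum>j\<in>{1..4}. \<beta> j) = 0"

lemma balanced_swap:
  assumes "balanced P Q \<alpha> \<beta>" shows "balanced Q P (\<lambda>i. - \<alpha> i) (\<lambda>j. - \<beta> j)"
proof -
  have "Q i j - P i j = - \<alpha> i - - \<beta> j" if "i \<in> {1..4}" "j \<in> {1..4}" for i j
  proof -
    have "P i j - Q i j = \<alpha> i - \<beta> j" using assms that unfolding balanced_def by blast
    then show ?thesis by linarith
  qed
  then show ?thesis
    using assms unfolding balanced_def sum_negf add.commute[of "Q _ _" "P _ _"] neg_equal_0_iff_equal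
    by blast
qed

lemma balanced_transpose:
  assumes "balanced P Q \<alpha> \<beta>"
  shows "balanced (\<lambda>i j. P j i) (\<lambda>i j. Q j i) (\<lambda>j. - \<beta> j) (\<lambda>i. - \<alpha> i)"
proof -
  have "P i j - Q i j = - \<beta> j - - \<alpha> i" if "i \<in> {1..4}" "j \<in> {1..4}" for i j
  proof -
    have "P i j - Q i j = \<alpha> i - \<beta> j" using assms that unfolding balanced_def by blast
    then show ?thesis by linarith
  qed
  then show ?thesis
    using assms unfolding balanced_def sum_negf neg_equal_0_iff_equal by blast
qed

text \<open>The facts come in the order of the premises of \<open>supports_ray_strict\<close> and
  \<open>supports_ray_degenerate\<close>, so that a single \<open>OF\<close> discharges them for
  arbitrary arrangements of rows and columns.\<close>

lemma balanced_enum: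
  assumes b: "balanced P Q \<alpha> \<beta>"
    and X: "{x0,x1,x2,x3} = {1..4::nat}" and Y: "{y0,y1,y2,y3} = {1..4::nat}"
  shows "0 \<le> P x0 y0" "0 \<le> Q x0 y0" "0 \<le> P x0 y1" "0 \<le> Q x0 y1" "0 \<le> P x0 y2" "0 \<le> Q x0 y2" "0 \<le> P x0 y3" "0 \<le> Q x0 y3"
    "0 \<le> P x1 y0" "0 \<le> Q x1 y0" "0 \<le> P x1 y1" "0 \<le> Q x1 y1" "0 \<le> P x1 y2" "0 \<le> Q x1 y2" "0 \<le> P x1 y3" "0 \<le> Q x1 y3"
    "0 \<le> P x2 y0" "0 \<le> Q x2 y0" "0 \<le> P x2 y1" "0 \<le> Q x2 y1" "0 \<le> P x2 y2" "0 \<le> Q x2 y2" "0 \<le> P x2 y3" "0 \<le> Q x2 y3"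
    "0 \<le> P x3 y0" "0 \<le> Q x3 y0" "0 \<le> P x3 y1" "0 \<le> Q x3 y1" "0 \<le> P x3 y2" "0 \<le> Q x3 y2" "0 \<le> P x3 y3" "0 \<le> Q x3 y3"
    "P x0 y0 - Q x0 y0 = \<alpha> x0 - \<beta> y0" "P x0 y1 - Q x0 y1 = \<alpha> x0 - \<beta> y1" "P x0 y2 - Q x0 y2 = \<alpha> x0 - \<beta> y2" "P x0 y3 - Q x0 y3 = \<alpha> x0 - \<beta> y3"
    "P x1 y0 - Q x1 y0 = \<alpha> x1 - \<beta> y0" "P x1 y1 - Q x1 y1 = \<alpha> x1 - \<beta> y1" "P x1 y2 - Q x1 y2 = \<alpha> x1 - \<beta> y2" "P x1 y3 - Q x1 y3 = \<alpha> x1 - \<beta> y3"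
    "P x2 y0 - Q x2 y0 = \<alpha> x2 - \<beta> y0" "P x2 y1 - Q x2 y1 = \<alpha> x2 - \<beta> y1" "P x2 y2 - Q x2 y2 = \<alpha> x2 - \<beta> y2" "P x2 y3 - Q x2 y3 = \<alpha> x2 - \<beta> y3"
    "P x3 y0 - Q x3 y0 = \<alpha> x3 - \<beta> y0" "P x3 y1 - Q x3 y1 = \<alpha> x3 - \<beta> y1" "P x3 y2 - Q x3 y2 = \<alpha> x3 - \<beta> y2" "P x3 y3 - Q x3 y3 = \<alpha> x3 - \<beta> y3"
    "P x0 y0 + Q x0 y0 + P x0 y1 + Q x0 y1 + P x0 y2 + Q x0 y2 + P x0 y3 + Q x0 y3 = 1"
    "P x1 y0 + Q x1 y0 + P x1 y1 + Q x1 y1 + P x1 y2 + Q x1 y2 + P x1 y3 + Q x1 y3 = 1"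
    "P x2 y0 + Q x2 y0 + P x2 y1 + Q x2 y1 + P x2 y2 + Q x2 y2 + P x2 y3 + Q x2 y3 = 1"
    "P x3 y0 + Q x3 y0 + P x3 y1 + Q x3 y1 + P x3 y2 + Q x3 y2 + P x3 y3 + Q x3 y3 = 1"
    "P x0 y0 + Q x0 y0 + P x1 y0 + Q x1 y0 + P x2 y0 + Q x2 y0 + P x3 y0 + Q x3 y0 = 1"
    "P x0 y1 + Q x0 y1 + P x1 y1 + Q x1 y1 + P x2 y1 + Q x2 y1 + P x3 y1 + Q x3 y1 = 1"
    "P x0 y2 + Q x0 y2 + P x1 y2 + Q x1 y2 + P x2 y2 + Q x2 y2 + P x3 y2 + Q x3 y2 = 1"
    "P x0 y3 + Q x0 y3 + P x1 y3 + Q x1 y3 + P x2 y3 + Q x2 y3 + P x3 y3 + Q x3 y3 = 1"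
    "\<alpha> x0 + \<alpha> x1 + \<alpha> x2 + \<alpha> x3 = 0" "\<beta> y0 + \<beta> y1 + \<beta> y2 + \<beta> y3 = 0"
proof -
  have m: "x0 \<in> {1..4}" "x1 \<in> {1..4}" "x2 \<in> {1..4}" "x3 \<in> {1..4}"
    "y0 \<in> {1..4}" "y1 \<in> {1..4}" "y2 \<in> {1..4}" "y3 \<in> {1..4}" using X Y by auto
  note b' = b[unfolded balanced_def]
  have n: "0 \<le> P i j" "0 \<le> Q i j" "P i j - Q i j = \<alpha> i - \<beta> j" if "i \<in> {1..4}" "j \<in> {1..4}" for i j
    using b' that by blast+
  have r: "(\<Sum>j\<in>{1..4}. P i j + Q i j) = 1" "(\<Sum>k\<in>{1..4}. P k i + Q k i) = 1" if "i \<in> {1..4}" for i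
    using b' that by blast+

  show "0 \<le> P x0 y0" "0 \<le> Q x0 y0" "P x0 y0 - Q x0 y0 = \<alpha> x0 - \<beta> y0" by (rule n m)+
  show "0 \<le> P x0 y1" "0 \<le> Q x0 y1" "P x0 y1 - Q x0 y1 = \<alpha> x0 - \<beta> y1" by (rule n m)+
  show "0 \<le> P x0 y2" "0 \<le> Q x0 y2" "P x0 y2 - Q x0 y2 = \<alpha> x0 - \<beta> y2" by (rule n m)+
  show "0 \<le> P x0 y3" "0 \<le> Q x0 y3" "P x0 y3 - Q x0 y3 = \<alpha> x0 - \<beta> y3" by (rule n m)+
  show "0 \<le> P x1 y0" "0 \<le> Q x1 y0" "P x1 y0 - Q x1 y0 = \<alpha> x1 - \<beta> y0" by (rule n m)+
  show "0 \<le> P x1 y1" "0 \<le> Q x1 y1" "P x1 y1 - Q x1 y1 = \<alpha> x1 - \<beta> y1" by (rule n m)+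
  show "0 \<le> P x1 y2" "0 \<le> Q x1 y2" "P x1 y2 - Q x1 y2 = \<alpha> x1 - \<beta> y2" by (rule n m)+
  show "0 \<le> P x1 y3" "0 \<le> Q x1 y3" "P x1 y3 - Q x1 y3 = \<alpha> x1 - \<beta> y3" by (rule n m)+
  show "0 \<le> P x2 y0" "0 \<le> Q x2 y0" "P x2 y0 - Q x2 y0 = \<alpha> x2 - \<beta> y0" by (rule n m)+
  show "0 \<le> P x2 y1" "0 \<le> Q x2 y1" "P x2 y1 - Q x2 y1 = \<alpha> x2 - \<beta> y1" by (rule n m)+
  show "0 \<le> P x2 y2" "0 \<le> Q x2 y2" "P x2 y2 - Q x2 y2 = \<alpha> x2 - \<beta> y2" by (rule n m)+
  show "0 \<le> P x2 y3" "0 \<le> Q x2 y3" "P x2 y3 - Q x2 y3 = \<alpha> x2 - \<beta> y3" by (rule n m)+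
  show "0 \<le> P x3 y0" "0 \<le> Q x3 y0" "P x3 y0 - Q x3 y0 = \<alpha> x3 - \<beta> y0" by (rule n m)+
  show "0 \<le> P x3 y1" "0 \<le> Q x3 y1" "P x3 y1 - Q x3 y1 = \<alpha> x3 - \<beta> y1" by (rule n m)+
  show "0 \<le> P x3 y2" "0 \<le> Q x3 y2" "P x3 y2 - Q x3 y2 = \<alpha> x3 - \<beta> y2" by (rule n m)+
  show "0 \<le> P x3 y3" "0 \<le> Q x3 y3" "P x3 y3 - Q x3 y3 = \<alpha> x3 - \<beta> y3" by (rule n m)+
  show "P x0 y0 + Q x0 y0 + P x0 y1 + Q x0 y1 + P x0 y2 + Q x0 y2 + P x0 y3 + Q x0 y3 = 1"
    using r(1)[OF m(1), unfolded sum_enum[OF Y]] by (simp only: add.assoc)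
  show "P x1 y0 + Q x1 y0 + P x1 y1 + Q x1 y1 + P x1 y2 + Q x1 y2 + P x1 y3 + Q x1 y3 = 1"
    using r(1)[OF m(2), unfolded sum_enum[OF Y]] by (simp only: add.assoc)
  show "P x2 y0 + Q x2 y0 + P x2 y1 + Q x2 y1 + P x2 y2 + Q x2 y2 + P x2 y3 + Q x2 y3 = 1"
    using r(1)[OF m(3), unfolded sum_enum[OF Y]] by (simp only: add.assoc)
  show "P x3 y0 + Q x3 y0 + P x3 y1 + Q x3 y1 + P x3 y2 + Q x3 y2 + P x3 y3 + Q x3 y3 = 1"
    using r(1)[OF m(4), unfolded sum_enum[OF Y]] by (simp only: add.assoc)
  show "P x0 y0 + Q x0 y0 + P x1 y0 + Q x1 y0 + P x2 y0 + Q x2 y0 + P x3 y0 + Q x3 y0 = 1"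
    using r(2)[OF m(5), unfolded sum_enum[OF X]] by (simp only: add.assoc)
  show "P x0 y1 + Q x0 y1 + P x1 y1 + Q x1 y1 + P x2 y1 + Q x2 y1 + P x3 y1 + Q x3 y1 = 1"
    using r(2)[OF m(6), unfolded sum_enum[OF X]] by (simp only: add.assoc)
  show "P x0 y2 + Q x0 y2 + P x1 y2 + Q x1 y2 + P x2 y2 + Q x2 y2 + P x3 y2 + Q x3 y2 = 1"
    using r(2)[OF m(7), unfolded sum_enum[OF X]] by (simp only: add.assoc)
  show "P x0 y3 + Q x0 y3 + P x1 y3 + Q x1 y3 + P x2 y3 + Q x2 y3 + P x3 y3 + Q x3 y3 = 1"
    using r(2)[OF m(8), unfolded sum_enum[OF X]] by (simp only: add.assoc)
  have "(\<Sum>i\<in>{1..4}. \<alpha> i) = 0" "(\<Sum>j\<in>{1..4}. \<beta> j) = 0" using b' by blast+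
  then show "\<alpha> x0 + \<alpha> x1 + \<alpha> x2 + \<alpha> x3 = 0" "\<beta> y0 + \<beta> y1 + \<beta> y2 + \<beta> y3 = 0"
    by (simp_all only: sum_enum[OF X, of \<alpha>] sum_enum[OF Y, of \<beta>])
qed

section \<open>Case analysis by the order of the potentials\<close>

lemma not_supports:
  assumes "\<not> supports P Q" "(S, T) \<in> rays"
  shows "(\<exists>(i,j)\<in>S. P i j \<le> 0) \<or> (\<exists>(i,j)\<in>T. Q i j \<le> 0)"
proof (rule ccontr)
  assume "\<not> ?thesis"
  then have "supports P Q"
    unfolding supports_def by (intro bexI[OF _ assms(2)]) (auto simp: split_beta not_le)
  then show False using assms(1) by contradiction
qed

lemma not_supports_perm:
  assumes "\<not> supports P Q" and "{a,b,c,d} = {1..4}" "{a',b',c',d'} = {1..4}"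
  shows "P a a' \<le> 0 \<or> P b b' \<le> 0 \<or> P c c' \<le> 0 \<or> P d d' \<le> 0 \<or> Q a a' \<le> 0 \<or> Q b b' \<le> 0 \<or> Q c c' \<le> 0 \<or> Q d d' \<le> 0"
  using not_supports[OF assms(1) rays.perm[OF assms(2,3)]] by simp

lemma not_supports_block:
  assumes "\<not> supports P Q" and "{a,b,c,d} = {1..4}" "{a',b',c',d'} = {1..4}"
  shows "P a a' \<le> 0 \<or> P a b' \<le> 0 \<or> P b a' \<le> 0 \<or> P b b' \<le> 0 \<or> Q c c' \<le> 0 \<or> Q c d' \<le> 0 \<or> Q d c' \<le> 0 \<or> Q d d' \<le> 0"
  using not_supports[OF assms(1) rays.block[OF assms(2,3)]] by simp

lemma not_supports_row:
  assumes "\<not> supports P Q" and "{a,b,c,d} = {1..4}" "{a',b',c',d'} = {1..4}"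
  shows "P a b' \<le> 0 \<or> P a c' \<le> 0 \<or> P a d' \<le> 0 \<or> P b b' \<le> 0 \<or> P c c' \<le> 0 \<or> P d d' \<le> 0 \<or> Q b a' \<le> 0 \<or> Q c a' \<le> 0 \<or> Q d a' \<le> 0 \<or> Q b b' \<le> 0 \<or> Q c c' \<le> 0 \<or> Q d d' \<le> 0"
  using not_supports[OF assms(1) rays.row[OF assms(2,3)]] by simp

lemma not_supports_col:
  assumes "\<not> supports P Q" and "{a,b,c,d} = {1..4}" "{a',b',c',d'} = {1..4}"
  shows "P b a' \<le> 0 \<or> P c a' \<le> 0 \<or> P d a' \<le> 0 \<or> P b b' \<le> 0 \<or> P c c' \<le> 0 \<or> P d d' \<le> 0 \<or> Q a b' \<le> 0 \<or> Q a c' \<le> 0 \<or> Q a d' \<le> 0 \<or> Q b b' \<le> 0 \<or> Q c c' \<le> 0 \<or> Q d d' \<le> 0"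
  using not_supports[OF assms(1) rays.col[OF assms(2,3)]] by simp

lemma supports_strict:
  assumes b: "balanced P Q \<alpha> \<beta>"
    and X: "{x0,x1,x2,x3} = {1..4::nat}" and Y: "{y0,y1,y2,y3} = {1..4::nat}"
    and le: "\<beta> y1 \<le> \<alpha> x0" "\<beta> y2 \<le> \<alpha> x0" "\<beta> y3 \<le> \<alpha> x0" "\<beta> y1 \<le> \<alpha> x1" "\<beta> y2 \<le> \<alpha> x1" "\<beta> y3 \<le> \<alpha> x1" "\<beta> y1 \<le> \<alpha> x2" "\<beta> y2 \<le> \<alpha> x2" "\<beta> y3 \<le> \<alpha> x2"
    and pos: "0 < P x0 y1" "0 < P x0 y2" "0 < P x0 y3" "0 < P x1 y1" "0 < P x1 y2" "0 < P x1 y3" "0 < P x2 y1" "0 < P x2 y2" "0 < P x2 y3"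
  shows "supports P Q"
proof (rule ccontr)
  assume N: "\<not> supports P Q"
  \<comment> \<open>Unification with a listed disjunction determines the shape of the ray and its
    two arrangements; \<open>insert_commute\<close> then recognises these as rearrangements of
    \<open>X\<close> and \<open>Y\<close>.\<close>
  show False
    by (rule supports_ray_strict[OF balanced_enum[OF b X Y] le pos])
      (rule not_supports_block[OF N] not_supports_perm[OF N] not_supports_row[OF N] not_supports_col[OF N],
        use X in \<open>simp add: insert_commute\<close>, use Y in \<open>simp add: insert_commute\<close>)+
qed

text \<open>The zero of \<open>P\<close> forces a tie \<open>\<alpha> x2 = \<beta> y1\<close>,
  because \<open>P - Q\<close> is nonnegative there by \<open>le\<close>. The remaining order
  conditions on \<open>x0\<close>, \<open>x1\<close> and on \<open>y2\<close>, \<open>y3\<close>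
  break the symmetry that is left, which keeps the selection of rays small.\<close>

lemma supports_degenerate:
  assumes b: "balanced P Q \<alpha> \<beta>"
    and X: "{x0,x1,x2,x3} = {1..4::nat}" and Y: "{y0,y1,y2,y3} = {1..4::nat}"
    and le: "\<beta> y1 \<le> \<alpha> x0" "\<beta> y2 \<le> \<alpha> x0" "\<beta> y3 \<le> \<alpha> x0" "\<beta> y1 \<le> \<alpha> x1" "\<beta> y2 \<le> \<alpha> x1" "\<beta> y3 \<le> \<alpha> x1" "\<beta> y1 \<le> \<alpha> x2" "\<beta> y2 \<le> \<alpha> x2" "\<beta> y3 \<le> \<alpha> x2"
    and deg: "P x2 y1 = 0" "\<alpha> x2 < \<beta> y0" "\<alpha> x1 \<le> \<alpha> x0" "\<beta> y3 \<le> \<beta> y2"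
  shows "supports P Q"
proof (rule ccontr)
  assume N: "\<not> supports P Q"
  show False
    by (rule supports_ray_degenerate[OF balanced_enum[OF b X Y] le deg])
      (rule not_supports_block[OF N] not_supports_perm[OF N] not_supports_row[OF N] not_supports_col[OF N],
        use X in \<open>simp add: insert_commute\<close>, use Y in \<open>simp add: insert_commute\<close>)+
qed

lemma enum3_order:
  fixes f :: "nat \<Rightarrow> real"
  assumes "x \<in> {a, b, c}"
  obtains a' b' where "{a', b', x} = {a, b, c}" "f b' \<le> f a'"
proof -
  have "{b, c, a} = {a, b, c}" "{a, c, b} = {a, b, c}" by auto
  then obtain u v where uv: "{u, v, x} = {a, b, c}" using assms by (metis insertE singletonD)
  show thesis
  proof (cases "f v \<le> f u")
    case True then show thesis using uv that by blast
  next
    case False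
    have "{v, u, x} = {a, b, c}" unfolding uv[symmetric] by auto
    then show thesis using False that[of v u] by simp
  qed
qed

text \<open>A zero of \<open>P\<close> in the 3 by 3 rectangle is a tie between the least of the
  three \<alpha> and the greatest of the three \<beta>. Either the outer potentials \<alpha> of
  \<open>x3\<close> and \<beta> of \<open>y0\<close> cross the tied value, which is the degenerate
  case or its transpose, or all eight potentials coincide and Birkhoff's argument applies.\<close>

lemma supports_ordered:
  assumes b: "balanced P Q \<alpha> \<beta>"
    and X: "{x0,x1,x2,x3} = {1..4::nat}" and Y: "{y0,y1,y2,y3} = {1..4::nat}"
    and le: "\<And>x y. x \<in> {x0,x1,x2} \<Longrightarrow> y \<in> {y1,y2,y3} \<Longrightarrow> \<beta> y \<le> \<alpha> x"
  shows "supports P Q"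
proof (cases "\<forall>x\<in>{x0,x1,x2}. \<forall>y\<in>{y1,y2,y3}. 0 < P x y")
  case True
  show ?thesis by (rule supports_strict[OF b X Y]) (use True le in auto)
next
  case False
  then obtain x y where xy: "x \<in> {x0,x1,x2}" "y \<in> {y1,y2,y3}" "\<not> 0 < P x y" by blast
  have xyI: "x \<in> {1..4}" "y \<in> {1..4}" using xy X Y by auto
  then have "0 \<le> P x y" "0 \<le> Q x y" "P x y - Q x y = \<alpha> x - \<beta> y"
    using b unfolding balanced_def by blast+
  with xy le[OF xy(1,2)] have P0: "P x y = 0" and eq: "\<alpha> x = \<beta> y" by linarith+
  obtain u v where uv: "{u, v, x} = {x0,x1,x2}" "\<alpha> v \<le> \<alpha> u"
    using enum3_order[OF xy(1)] by blast
  obtain w z where wz: "{w, z, y} = {y1,y2,y3}" "\<beta> z \<le> \<beta> w"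
    using enum3_order[OF xy(2)] by blast
  have "{u,v,x,x3} = insert x3 {u,v,x}" by auto
  also have "\<dots> = {x0,x1,x2,x3}" unfolding uv(1) by auto
  finally have X': "{u,v,x,x3} = {1..4}" using X by simp
  have "{y0,y,w,z} = insert y0 {w,z,y}" by auto
  also have "\<dots> = {y0,y1,y2,y3}" unfolding wz(1) by auto
  finally have Y': "{y0,y,w,z} = {1..4}" using Y by simp
  have le': "\<beta> t \<le> \<alpha> s" if "s \<in> {u,v,x}" "t \<in> {w,z,y}" for s t
    using that unfolding uv(1) wz(1) by (rule le)
  note les = le'[of u y] le'[of u w] le'[of u z] le'[of v y] le'[of v w] le'[of v z]
    le'[of x y] le'[of x w] le'[of x z]
  note les = les[simplified]
  consider "\<alpha> x < \<beta> y0" | "\<alpha> x3 < \<beta> y" | "\<beta> y0 \<le> \<alpha> x" "\<alpha> x = \<beta> y" "\<beta> y \<le> \<alpha> x3"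
    using eq by linarith
  then show ?thesis
  proof cases
    case 1
    show ?thesis by (rule supports_degenerate[OF b X' Y']) (use les P0 1 uv wz in simp_all)
  next
    case 2
    \<comment> \<open>Transposition replaces the potentials by \<open>- \<beta>\<close> and
      \<open>- \<alpha>\<close>. Both arrangements are listed so that the tie falls on the position
      \<open>P x2 y1\<close> of \<open>supports_degenerate\<close> and the reversed orders meet its
      last two conditions.\<close>
    have X'': "{z,w,y,y0} = {1..4}" and Y'': "{x3,x,v,u} = {1..4}" using X' Y' by auto
    have "supports (\<lambda>i j. P j i) (\<lambda>i j. Q j i)"
      by (rule supports_degenerate[OF balanced_transpose[OF b] X'' Y'']) (use les P0 2 uv wz in simp_all)
    then show ?thesis by (rule supports_transpose)
  next
    case 3
    note e = balanced_enum[OF b X' Y']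
    \<comment> \<open>All \<alpha> are at least the tied value and all \<beta> at most this value.
      As both families sum to zero, all of them are equal; then \<open>P = Q\<close>, and every line
      of \<open>P\<close> sums to one half.\<close>
    have "\<alpha> u + \<alpha> v + \<alpha> x + \<alpha> x3 = 0" "\<beta> y0 + \<beta> y + \<beta> w + \<beta> z = 0" using e by blast+
    then have eqs: "\<alpha> u = \<alpha> x" "\<alpha> v = \<alpha> x" "\<alpha> x3 = \<alpha> x" "\<beta> w = \<alpha> x" "\<beta> z = \<alpha> x" "\<beta> y0 = \<alpha> x" "\<beta> y = \<alpha> x"
      using 3 les by simp_all
    from eqs have c: "\<alpha> i = \<alpha> x" "\<beta> j = \<alpha> x" if "i \<in> {u,v,x,x3}" "j \<in> {y0,y,w,z}" for i j
      using that by auto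
    have PQ: "Q i j = P i j" if "i \<in> {1..4}" "j \<in> {1..4}" for i j
    proof -
      have "P i j - Q i j = \<alpha> i - \<beta> j" using b that unfolding balanced_def by blast
      then show ?thesis using c[unfolded X' Y', OF that] by simp
    qed
    have m: "u \<in> {1..4}" "v \<in> {1..4}" "x \<in> {1..4}" "x3 \<in> {1..4}" unfolding X'[symmetric] by simp_all
    have m': "y0 \<in> {1..4}" "y \<in> {1..4}" "w \<in> {1..4}" "z \<in> {1..4}" unfolding Y'[symmetric] by simp_all
    have sums: "P u y0 + P u y + P u w + P u z = 1 / 2"
      "P v y0 + P v y + P v w + P v z = 1 / 2"
      "P x y0 + P x y + P x w + P x z = 1 / 2"
      "P x3 y0 + P x3 y + P x3 w + P x3 z = 1 / 2"
      "P u y0 + P v y0 + P x y0 + P x3 y0 = 1 / 2"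
      "P u y + P v y + P x y + P x3 y = 1 / 2"
      "P u w + P v w + P x w + P x3 w = 1 / 2"
      "P u z + P v z + P x z + P x3 z = 1 / 2"
    proof -
      show "P u y0 + P u y + P u w + P u z = 1 / 2" using e(49) PQ[OF m(1) m'(1)] PQ[OF m(1) m'(2)] PQ[OF m(1) m'(3)] PQ[OF m(1) m'(4)] by linarith
      show "P v y0 + P v y + P v w + P v z = 1 / 2" using e(50) PQ[OF m(2) m'(1)] PQ[OF m(2) m'(2)] PQ[OF m(2) m'(3)] PQ[OF m(2) m'(4)] by linarith
      show "P x y0 + P x y + P x w + P x z = 1 / 2" using e(51) PQ[OF m(3) m'(1)] PQ[OF m(3) m'(2)] PQ[OF m(3) m'(3)] PQ[OF m(3) m'(4)] by linarith
      show "P x3 y0 + P x3 y + P x3 w + P x3 z = 1 / 2" using e(52) PQ[OF m(4) m'(1)] PQ[OF m(4) m'(2)] PQ[OF m(4) m'(3)] PQ[OF m(4) m'(4)] by linarith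
      show "P u y0 + P v y0 + P x y0 + P x3 y0 = 1 / 2" using e(53) PQ[OF m(1) m'(1)] PQ[OF m(2) m'(1)] PQ[OF m(3) m'(1)] PQ[OF m(4) m'(1)] by linarith
      show "P u y + P v y + P x y + P x3 y = 1 / 2" using e(54) PQ[OF m(1) m'(2)] PQ[OF m(2) m'(2)] PQ[OF m(3) m'(2)] PQ[OF m(4) m'(2)] by linarith
      show "P u w + P v w + P x w + P x3 w = 1 / 2" using e(55) PQ[OF m(1) m'(3)] PQ[OF m(2) m'(3)] PQ[OF m(3) m'(3)] PQ[OF m(4) m'(3)] by linarith
      show "P u z + P v z + P x z + P x3 z = 1 / 2" using e(56) PQ[OF m(1) m'(4)] PQ[OF m(2) m'(4)] PQ[OF m(3) m'(4)] PQ[OF m(4) m'(4)] by linarith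
    qed
    show ?thesis
    proof (rule ccontr)
      assume N: "\<not> supports P Q"
      have perm: "P a a' \<le> 0 \<or> P b b' \<le> 0 \<or> P c c' \<le> 0 \<or> P d d' \<le> 0"
        if "{a,b,c,d} = {1..4}" "{a',b',c',d'} = {1..4}" for a b c d a' b' c' d'
      proof -
        have "a \<in> {1..4}" "b \<in> {1..4}" "c \<in> {1..4}" "d \<in> {1..4}" unfolding that(1)[symmetric] by simp_all
        moreover have "a' \<in> {1..4}" "b' \<in> {1..4}" "c' \<in> {1..4}" "d' \<in> {1..4}" unfolding that(2)[symmetric] by simp_all
        ultimately show ?thesis using not_supports_perm[OF N that] by (simp add: PQ) blast
      qed
      show False
        by (rule supports_perm[OF e(1) e(3) e(5) e(7) e(9) e(11) e(13) e(15) e(17) e(19) e(21) e(23) e(25) e(27) e(29) e(31) sums])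
          ((rule perm, use X' in \<open>simp add: insert_commute\<close>, use Y' in \<open>simp add: insert_commute\<close>)+, simp)
    qed
  qed
qed

lemma balanced_supports:
  assumes b: "balanced P Q \<alpha> \<beta>"
  shows "supports P Q"
proof -
  obtain x0 x1 x2 x3 where X: "{x0,x1,x2,x3} = {1..4}" and x: "\<alpha> x0 \<ge> \<alpha> x1" "\<alpha> x1 \<ge> \<alpha> x2" "\<alpha> x2 \<ge> \<alpha> x3"
    by (rule enum_sorted[of \<alpha>])
  obtain y0 y1 y2 y3 where Y: "{y0,y1,y2,y3} = {1..4}" and y: "\<beta> y0 \<ge> \<beta> y1" "\<beta> y1 \<ge> \<beta> y2" "\<beta> y2 \<ge> \<beta> y3"
    by (rule enum_sorted[of \<beta>])
  \<comment> \<open>In the last case the two largest \<alpha> exceed the two smallest \<beta>, so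
    \<open>P > Q\<close> on that 2 by 2 corner, and \<open>Q > P\<close> on the opposite corner: a
    block ray is visible directly. The second case is the first one after exchanging
    \<open>P\<close> and \<open>Q\<close>, which reverses both orders.\<close>
  consider "\<beta> y1 \<le> \<alpha> x2" | "\<alpha> x1 \<le> \<beta> y2" | "\<beta> y1 > \<alpha> x2" "\<alpha> x1 > \<beta> y2" by linarith
  then show ?thesis
  proof cases
    case 1
    show ?thesis by (rule supports_ordered[OF b X Y]) (use 1 x y in auto)
  next
    case 2
    have X': "{x3,x2,x1,x0} = {1..4}" and Y': "{y3,y2,y1,y0} = {1..4}" using X Y by auto
    have "supports Q P" by (rule supports_ordered[OF balanced_swap[OF b] X' Y']) (use 2 x y in auto)
    then show ?thesis by (rule supports_swap)
  next
    case 3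
    have Y': "{y2,y3,y0,y1} = {1..4}" using Y by auto
    note e = balanced_enum[OF b X Y]
    have "0 < P x0 y2" "0 < P x0 y3" "0 < P x1 y2" "0 < P x1 y3"
      using e(6,8,14,16) e(35,36,39,40) x y 3 by linarith+
    moreover have "0 < Q x2 y0" "0 < Q x2 y1" "0 < Q x3 y0" "0 < Q x3 y1"
      using e(17,19,25,27) e(41,42,45,46) x y 3 by linarith+
    ultimately show ?thesis unfolding supports_def
      by (intro bexI[OF _ rays.block[OF X Y']]) simp
  qed
qed

section \<open>Generation of the cone by rays\<close>

definition ind :: "(nat \<times> nat) set \<Rightarrow> nat \<Rightarrow> nat \<Rightarrow> real" where
  "ind S i j = (if (i,j) \<in> S then 1 else 0)"

lemma slack_cone: "slack (\<lambda>i j. p i j + c * q i j) r s = slack p r s + c * slack q r s"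
  unfolding slack_def by (simp add: sum.distrib sum_distrib_left[symmetric] algebra_simps add_divide_distrib)

lemma slack_enum:
  assumes X: "{x0,x1,x2,x3} = {1..4}" and Y: "{y0,y1,y2,y3} = {1..4}"
  shows "slack p r s = p r s - ((p r y0 + p r y1 + p r y2 + p r y3) + (p x0 s + p x1 s + p x2 s + p x3 s)) / 2
    + ((p x0 y0 + p x0 y1 + p x0 y2 + p x0 y3) + (p x1 y0 + p x1 y1 + p x1 y2 + p x1 y3)
      + (p x2 y0 + p x2 y1 + p x2 y2 + p x2 y3) + (p x3 y0 + p x3 y1 + p x3 y2 + p x3 y3)) / 4"
  unfolding slack_def
  unfolding sum_enum[OF X, of "\<lambda>i. p i s"] sum_enum[OF X, of "\<lambda>i. \<Sum>j\<in>{1..4}. p i j"]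
  unfolding sum_enum[OF Y] ..

text \<open>Together with linearity of \<open>slack\<close> this shows that subtracting a multiple
  of \<open>ind S\<close> from \<open>p\<close> subtracts the same multiple of \<open>ind T\<close>
  from \<open>slack p\<close> on the indices in question.\<close>

lemma slack_ind:
  assumes "(S, T) \<in> rays" "i \<in> {1..4}" "j \<in> {1..4}"
  shows "slack (ind S) i j = ind T i j"
  using assms
proof (induction S T rule: rays.induct)
  case (perm a b c d a' b' c' d')
  have "i \<in> {a,b,c,d}" "j \<in> {a',b',c',d'}" using perm by simp_all
  then show ?case
    unfolding slack_enum[OF perm(1,2)] ind_def
    using enum_distinct[OF perm(1)] enum_distinct[OF perm(2)] by (elim insertE emptyE) simp_all
next
  case (block a b c d a' b' c' d')
  have "i \<in> {a,b,c,d}" "j \<in> {a',b',c',d'}" using block by simp_all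
  then show ?case
    unfolding slack_enum[OF block(1,2)] ind_def
    using enum_distinct[OF block(1)] enum_distinct[OF block(2)] by (elim insertE emptyE) simp_all
next
  case (row a b c d a' b' c' d')
  have "i \<in> {a,b,c,d}" "j \<in> {a',b',c',d'}" using row by simp_all
  then show ?case
    unfolding slack_enum[OF row(1,2)] ind_def
    using enum_distinct[OF row(1)] enum_distinct[OF row(2)] by (elim insertE emptyE) simp_all
next
  case (col a b c d a' b' c' d')
  have "i \<in> {a,b,c,d}" "j \<in> {a',b',c',d'}" using col by simp_all
  then show ?case
    unfolding slack_enum[OF col(1,2)] ind_def
    using enum_distinct[OF col(1)] enum_distinct[OF col(2)] by (elim insertE emptyE) simp_all
qed

lemma rays_subset:
  assumes "(S, T) \<in> rays"
  shows "S \<subseteq> {1..4} \<times> {1..4}" "T \<subseteq> {1..4} \<times> {1..4}" "S \<noteq> {}"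
proof -
  have "S \<subseteq> {1..4} \<times> {1..4} \<and> T \<subseteq> {1..4} \<times> {1..4} \<and> S \<noteq> {}"
    using assms
  proof (induction S T rule: rays.induct)
    case (perm a b c d a' b' c' d')
    have "\<forall>x\<in>{a,b,c,d}. x \<in> {1..4}" "\<forall>x\<in>{a',b',c',d'}. x \<in> {1..4}" unfolding perm by simp_all
    then show ?case by simp
  next
    case (block a b c d a' b' c' d')
    have "\<forall>x\<in>{a,b,c,d}. x \<in> {1..4}" "\<forall>x\<in>{a',b',c',d'}. x \<in> {1..4}" unfolding block by simp_all
    then show ?case by simp
  next
    case (row a b c d a' b' c' d')
    have "\<forall>x\<in>{a,b,c,d}. x \<in> {1..4}" "\<forall>x\<in>{a',b',c',d'}. x \<in> {1..4}" unfolding row by simp_all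
    then show ?case by simp
  next
    case (col a b c d a' b' c' d')
    have "\<forall>x\<in>{a,b,c,d}. x \<in> {1..4}" "\<forall>x\<in>{a',b',c',d'}. x \<in> {1..4}" unfolding col by simp_all
    then show ?case by simp
  qed
  then show "S \<subseteq> {1..4} \<times> {1..4}" "T \<subseteq> {1..4} \<times> {1..4}" "S \<noteq> {}" by blast+
qed

lemma ppt_supports:
  assumes p: "ppt p" and nz: "i0 \<in> {1..4}" "j0 \<in> {1..4}" "p i0 j0 \<noteq> 0"
  shows "supports p (slack p)"
proof -
  define R C t where "R = (\<lambda>i. \<Sum>j\<in>{1..4}. p i j)" and "C = (\<lambda>j. \<Sum>i\<in>{1..4}. p i j)"
    and "t = (\<Sum>i\<in>{1..4}. \<Sum>j\<in>{1..4}. p i j)"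
  have p0: "0 \<le> p i j" "0 \<le> slack p i j" if "i \<in> {1..4}" "j \<in> {1..4}" for i j
    using p that unfolding ppt_def by blast+
  have tR: "t = (\<Sum>i\<in>{1..4}. R i)" unfolding t_def R_def ..
  have tC: "t = (\<Sum>j\<in>{1..4}. C j)" unfolding t_def C_def by (rule sum.swap)
  have "0 < p i0 j0" using p0[OF nz(1,2)] nz(3) by linarith
  also have "\<dots> \<le> R i0" unfolding R_def by (rule member_le_sum) (use nz p0 in auto)
  also have "\<dots> \<le> t" unfolding tR by (rule member_le_sum) (use nz p0 in \<open>auto simp: R_def intro!: sum_nonneg\<close>)
  finally have t: "0 < t" .
  have sl: "slack p i j = p i j - (R i + C j) / 2 + t / 4" for i j
    unfolding slack_def R_def C_def t_def by simp
  have sumR: "(\<Sum>j\<in>{1..4}. p i j + slack p i j) = t / 2" for i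
  proof -
    have "(\<Sum>j\<in>{1..4}. p i j + slack p i j) = 2 * R i - (4 * R i + (\<Sum>j\<in>{1..4}. C j)) / 2 + t"
      unfolding sl R_def sum_idx by (simp add: field_simps)
    then show ?thesis unfolding tC[symmetric] by (simp add: field_simps)
  qed
  have sumC: "(\<Sum>i\<in>{1..4}. p i j + slack p i j) = t / 2" for j
  proof -
    have "(\<Sum>i\<in>{1..4}. p i j + slack p i j) = 2 * C j - (4 * C j + (\<Sum>i\<in>{1..4}. R i)) / 2 + t"
      unfolding sl C_def sum_idx by (simp add: field_simps)
    then show ?thesis unfolding tR[symmetric] by (simp add: field_simps)
  qed
  \<comment> \<open>Each line of \<open>p + slack p\<close> sums to \<open>t / 2\<close>, and the
    factor \<open>2 / t\<close> normalises this to 1. The difference \<open>p - slack p\<close> is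
    \<open>(R i + C j) / 2 - t / 4\<close>; splitting the constant into two halves
    \<open>t / 8\<close> makes each potential sum to zero.\<close>
  define k where "k = 2 / t"
  have k: "0 < k" "k * t = 2" using t by (simp_all add: k_def)
  have "balanced (\<lambda>i j. k * p i j) (\<lambda>i j. k * slack p i j)
      (\<lambda>i. k * (R i / 2 - t / 8)) (\<lambda>j. - (k * (C j / 2 - t / 8)))"
    unfolding balanced_def
  proof (intro conjI ballI)
    fix i j :: nat assume "i \<in> {1..4}" "j \<in> {1..4}"
    then show "0 \<le> k * p i j" "0 \<le> k * slack p i j" using k p0 by simp_all
    show "k * p i j - k * slack p i j = k * (R i / 2 - t / 8) - - (k * (C j / 2 - t / 8))"
      unfolding sl by (simp add: field_simps)
  next
    fix i :: nat
    show "(\<Sum>j\<in>{1..4}. k * p i j + k * slack p i j) = 1"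
      unfolding distrib_left[symmetric] sum_distrib_left[symmetric] sumR using k(2) by simp
  next
    fix j :: nat
    show "(\<Sum>i\<in>{1..4}. k * p i j + k * slack p i j) = 1"
      unfolding distrib_left[symmetric] sum_distrib_left[symmetric] sumC using k(2) by simp
  next
    show "(\<Sum>i\<in>{1..4}. k * (R i / 2 - t / 8)) = 0"
      unfolding tR sum_idx by (simp add: algebra_simps)
    show "(\<Sum>j\<in>{1..4}. - (k * (C j / 2 - t / 8))) = 0"
      unfolding tC sum_idx by (simp add: algebra_simps)
  qed
  from balanced_supports[OF this] show ?thesis
    using k by (simp add: supports_def zero_less_mult_iff)
qed

definition nzero :: "(nat \<Rightarrow> nat \<Rightarrow> real) \<Rightarrow> (nat \<times> nat) set" where
  "nzero p = {(i,j). i \<in> {1..4} \<and> j \<in> {1..4} \<and> p i j \<noteq> 0}"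

lemma finite_nzero: "finite (nzero p)"
  by (rule finite_subset[of _ "{1..4} \<times> {1..4}"]) (auto simp: nzero_def)

text \<open>Subtracting the largest admissible multiple of a supported ray creates a new zero, hence termination.\<close>

lemma ppt_induct [consumes 1, case_names zero step]:
  assumes "ppt p"
    and zero: "\<And>p. (\<And>i j. i \<in> {1..4} \<Longrightarrow> j \<in> {1..4} \<Longrightarrow> p i j = 0) \<Longrightarrow> K p"
    and step: "\<And>p S T c. (S, T) \<in> rays \<Longrightarrow> 0 \<le> c \<Longrightarrow> K p \<Longrightarrow> K (\<lambda>i j. p i j + c * ind S i j)"
  shows "K p"
  using assms(1)
proof (induction "card (nzero p) + card (nzero (slack p))" arbitrary: p rule: less_induct)
  case less
  show ?case
  proof (cases "\<forall>i\<in>{1..4}. \<forall>j\<in>{1..4}. p i j = 0")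
    case True
    then show ?thesis by (intro zero) blast
  next
    case False
    then have "supports p (slack p)" using ppt_supports[OF less.prems] by blast
    then obtain S T where ST: "(S, T) \<in> rays"
      and pos: "\<forall>(i,j)\<in>S. 0 < p i j" "\<forall>(i,j)\<in>T. 0 < slack p i j"
      unfolding supports_def by blast
    note sub = rays_subset[OF ST]
    define M where "M = (\<lambda>(i,j). p i j) ` S \<union> (\<lambda>(i,j). slack p i j) ` T"
    define c where "c = Min M"
    have "finite S" "finite T" using sub(1,2) by (meson finite_SigmaI finite_atLeastAtMost finite_subset)+
    then have M: "finite M" "M \<noteq> {}" using sub(3) by (auto simp: M_def)
    have c_in: "c \<in> M" unfolding c_def by (rule Min_in[OF M])
    have c_le: "c \<le> x" if "x \<in> M" for x unfolding c_def by (rule Min_le[OF M(1) that])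
    have c_pos: "0 < c" using c_in pos unfolding M_def by auto
    define p' where "p' = (\<lambda>i j. p i j + (- c) * ind S i j)"
    have sl: "slack p' i j = slack p i j - c * ind T i j" if "i \<in> {1..4}" "j \<in> {1..4}" for i j
      unfolding p'_def slack_cone slack_ind[OF ST that] by simp
    have cS: "c \<le> p i j" if "(i,j) \<in> S" for i j using c_le that unfolding M_def by force
    have cT: "c \<le> slack p i j" if "(i,j) \<in> T" for i j using c_le that unfolding M_def by force
    have "ppt p'"
      using less.prems sl cS cT unfolding ppt_def by (simp add: p'_def ind_def)
    \<comment> \<open>The subtraction changes only entries in the supports, and these were positive
      already, so no zero is lost.\<close>
    have sub1: "nzero p' \<subseteq> nzero p"
    proof
      fix x assume "x \<in> nzero p'"
      then obtain i j where x: "x = (i,j)" "i \<in> {1..4}" "j \<in> {1..4}" "p' i j \<noteq> 0"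
        unfolding nzero_def by blast
      have "p i j \<noteq> 0"
      proof (cases "(i,j) \<in> S")
        case True then have "0 < p i j" using pos by blast
        then show ?thesis by simp
      next
        case False then show ?thesis using x(4) by (simp add: p'_def ind_def)
      qed
      then show "x \<in> nzero p" using x unfolding nzero_def by simp
    qed
    have sub2: "nzero (slack p') \<subseteq> nzero (slack p)"
    proof
      fix x assume "x \<in> nzero (slack p')"
      then obtain i j where x: "x = (i,j)" "i \<in> {1..4}" "j \<in> {1..4}" "slack p' i j \<noteq> 0"
        unfolding nzero_def by blast
      have "slack p i j \<noteq> 0"
      proof (cases "(i,j) \<in> T")
        case True then have "0 < slack p i j" using pos by blast
        then show ?thesis by simp
      next
        case False then show ?thesis using x(4) sl[OF x(2,3)] by (simp add: ind_def)
      qed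
      then show "x \<in> nzero (slack p)" using x unfolding nzero_def by simp
    qed
    have "nzero p' \<noteq> nzero p \<or> nzero (slack p') \<noteq> nzero (slack p)"
      using c_in unfolding M_def
    proof
      assume "c \<in> (\<lambda>(i,j). p i j) ` S"
      then obtain i j where ij: "(i,j) \<in> S" "c = p i j" by auto
      then have "(i,j) \<in> nzero p" "(i,j) \<notin> nzero p'"
        using sub c_pos unfolding nzero_def p'_def ind_def by auto
      then show ?thesis by blast
    next
      assume "c \<in> (\<lambda>(i,j). slack p i j) ` T"
      then obtain i j where ij: "(i,j) \<in> T" "c = slack p i j" by auto
      have "i \<in> {1..4}" "j \<in> {1..4}" using ij sub by auto
      then have "(i,j) \<in> nzero (slack p)" "(i,j) \<notin> nzero (slack p')"
        using ij c_pos sl[of i j] unfolding nzero_def ind_def by auto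
      then show ?thesis by blast
    qed
    then have "card (nzero p') + card (nzero (slack p')) < card (nzero p) + card (nzero (slack p))"
      using psubset_card_mono[OF finite_nzero, of "nzero p'" p] psubset_card_mono[OF finite_nzero, of "nzero (slack p')" "slack p"]
        card_mono[OF finite_nzero sub1] card_mono[OF finite_nzero sub2] sub1 sub2
      unfolding psubset_eq by (elim disjE) (simp_all add: add_less_le_mono add_le_less_mono)
    from less.hyps[OF this \<open>ppt p'\<close>] have "K p'" .
    then have "K (\<lambda>i j. p' i j + c * ind S i j)" using step[OF ST] c_pos by simp
    then show ?thesis unfolding p'_def by simp
  qed
qed

section \<open>Products of rays\<close>

lemma chr_commute: "chr r i = chr i r"
  by (auto simp: chr_def)

lemma chr_one [simp]: "chr r (Suc 0) = 1" "chr (Suc 0) r = 1"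
  by (simp_all add: chr_def)

definition blk :: "nat \<Rightarrow> real \<Rightarrow> nat \<Rightarrow> real \<Rightarrow> nat \<Rightarrow> nat \<Rightarrow> real" where
  "blk a e b d i j =
    (if i = 1 then 1 else if i = a then e else 0) * (if j = 1 then 1 else if j = b then d else 0)"

text \<open>The third sign is \<open>e * d\<close> because the third element of the commuting set
  is, up to phase, the product of the other two. The set commutes since distinct nonidentity Pauli
  matrices anticommute in both tensor factors.\<close>

definition prm :: "nat \<Rightarrow> nat \<Rightarrow> real \<Rightarrow> nat \<Rightarrow> nat \<Rightarrow> real \<Rightarrow> nat \<Rightarrow> nat \<Rightarrow> nat \<Rightarrow> nat \<Rightarrow> real" where
  "prm u1 w1 e u2 w2 d u3 w3 i j =
    (if i = 1 then (if j = 1 then 1 else 0)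
     else if i = u1 then (if j = w1 then e else 0)
     else if i = u2 then (if j = w2 then d else 0)
     else if i = u3 then (if j = w3 then e * d else 0) else 0)"

text \<open>
  The generators are the sign characters on a maximal commuting set of Pauli matrices: either
  \<open>{1, a} \<times> {1, b}\<close> or the graph of a permutation fixing \<open>1\<close>. Only the indices \<open>1..4\<close> matter,
  hence the rule \<open>cong\<close>.
\<close>

inductive stab :: "(nat \<Rightarrow> nat \<Rightarrow> real) \<Rightarrow> bool" where
  blk: "a \<in> {2,3,4} \<Longrightarrow> b \<in> {2,3,4} \<Longrightarrow> e \<in> {1,-1} \<Longrightarrow> d \<in> {1,-1} \<Longrightarrow> stab (blk a e b d)"
| prm: "{u1,u2,u3} = {2,3,4} \<Longrightarrow> {w1,w2,w3} = {2,3,4} \<Longrightarrow> e \<in> {1,-1} \<Longrightarrow> d \<in> {1,-1} \<Longrightarrow>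
    stab (prm u1 w1 e u2 w2 d u3 w3)"
| add: "stab \<mu> \<Longrightarrow> stab \<nu> \<Longrightarrow> stab (\<lambda>i j. \<mu> i j + \<nu> i j)"
| scale: "stab \<mu> \<Longrightarrow> 0 \<le> c \<Longrightarrow> stab (\<lambda>i j. c * \<mu> i j)"
| cong: "stab \<mu> \<Longrightarrow> (\<And>i j. i \<in> {1..4} \<Longrightarrow> j \<in> {1..4} \<Longrightarrow> \<mu> i j = \<nu> i j) \<Longrightarrow> stab \<nu>"

lemma enum_one:
  assumes "{u,v,w} = {2,3,4::nat}"
  shows "{1,u,v,w} = {1..4}"
proof -
  have "{1..4} = insert 1 {2,3,4::nat}" by auto
  then show ?thesis unfolding assms[symmetric] by simp
qed

lemma stab_zero: "stab (\<lambda>i j. 0)"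
  using stab.scale[OF stab.blk[of 2 2 1 1], of 0] by simp

lemma stab_sum:
  assumes "\<And>x. x \<in> A \<Longrightarrow> stab (f x)"
  shows "stab (\<lambda>i j. \<Sum>x\<in>A. f x i j)"
proof (cases "finite A")
  case True
  then show ?thesis using assms
    by (induction A rule: finite_induct) (auto intro: stab_zero stab.add)
next
  case False
  then show ?thesis by (simp add: stab_zero)
qed

lemma chr_sign: "chr r i \<in> {1, -1}"
  by (auto simp: chr_def)

lemma sign_mult: "x \<in> {1, -1} \<Longrightarrow> y \<in> {1, -1} \<Longrightarrow> x * y \<in> {1, - 1 :: real}"
  by auto

text \<open>In the Klein four-group the product of two distinct nonidentity elements is the third,
  and characters are multiplicative.\<close>

lemma chr_prod:
  assumes "{u,v,w} = {2,3,4}" "r \<in> {1..4}"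
  shows "chr r w = chr r u * chr r v"
proof -
  have "r \<in> {1,u,v,w}" using assms enum_one by simp
  then show ?thesis
    using enum_distinct[OF enum_one[OF assms(1)]] by (elim insertE emptyE) (simp_all add: chr_def)
qed

text \<open>Multiplying by a character only changes the signs \<open>e\<close> and \<open>d\<close>
  of a generator; \<open>chr_prod\<close> ensures that the third sign of \<open>prm\<close> stays
  the product of the other two.\<close>

lemma stab_twist:
  assumes "stab \<mu>" "r \<in> {1..4}" "c \<in> {1..4}"
  shows "stab (\<lambda>i j. chr r i * chr c j * \<mu> i j)"
  using assms
proof (induction rule: stab.induct)
  case (blk a b e d)
  have "stab (blk a (chr r a * e) b (chr c b * d))"
    by (intro stab.blk sign_mult chr_sign blk)
  moreover have "blk a (chr r a * e) b (chr c b * d) = (\<lambda>i j. chr r i * chr c j * blk a e b d i j)"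
    by (intro ext) (simp add: blk_def)
  ultimately show ?case by simp
next
  case (prm u1 u2 u3 w1 w2 w3 e d)
  have "stab (prm u1 w1 (chr r u1 * chr c w1 * e) u2 w2 (chr r u2 * chr c w2 * d) u3 w3)"
    by (intro stab.prm sign_mult chr_sign prm)
  moreover have "prm u1 w1 (chr r u1 * chr c w1 * e) u2 w2 (chr r u2 * chr c w2 * d) u3 w3
      = (\<lambda>i j. chr r i * chr c j * prm u1 w1 e u2 w2 d u3 w3 i j)"
    using chr_prod[OF prm(1), of r] chr_prod[OF prm(2), of c] prm(5,6)
      enum_distinct[OF enum_one[OF prm(1)]] enum_distinct[OF enum_one[OF prm(2)]]
    by (intro ext) (simp add: prm_def)
  ultimately show ?case by simp
next
  case (add \<mu> \<nu>)
  then show ?case using stab.add by (simp add: distrib_left)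
next
  case (scale \<mu> k)
  then show ?case using stab.scale[of "\<lambda>i j. chr r i * chr c j * \<mu> i j" k] by (simp add: mult.left_commute)
next
  case (cong \<mu> \<nu>)
  show ?case by (rule stab.cong[OF cong.IH]) (use cong in auto)
qed

text \<open>On the indices considered, \<open>pauli_ft p\<close> is a nonnegative combination of
  characters when \<open>p\<close> is nonnegative, so the product is a nonnegative combination of
  twists of \<mu>.\<close>

lemma stab_mult_pauli_ft:
  assumes "stab \<mu>" and p: "\<And>r s. r \<in> {1..4} \<Longrightarrow> s \<in> {1..4} \<Longrightarrow> 0 \<le> p r s"
  shows "stab (\<lambda>i j. \<mu> i j * pauli_ft p i j)"
proof -
  have "stab (\<lambda>i j. \<Sum>r\<in>{1..4}. \<Sum>s\<in>{1..4}. p r s * (chr r i * chr s j * \<mu> i j))"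
    by (intro stab_sum stab.scale stab_twist assms)
  moreover have "(\<Sum>r\<in>{1..4}. \<Sum>s\<in>{1..4}. p r s * (chr r i * chr s j * \<mu> i j)) = \<mu> i j * pauli_ft p i j" for i j
    unfolding pauli_ft_def sum_distrib_left
    by (intro sum.cong refl) (simp add: chr_commute[of i] chr_commute[of j])
  ultimately show ?thesis by simp
qed

text \<open>Transforms of the rays of shape \<open>row\<close> and \<open>col\<close>, up to scaling and twisting by characters.\<close>

definition trow :: "nat \<Rightarrow> nat \<Rightarrow> nat \<Rightarrow> nat \<Rightarrow> nat \<Rightarrow> nat \<Rightarrow> nat \<Rightarrow> nat \<Rightarrow> real" where
  "trow u1 w1 u2 w2 u3 w3 i j = 2 * (if j = 1 then 1 else 0) + 2 * prm u1 w1 1 u2 w2 1 u3 w3 i j - 1"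

definition tcol :: "nat \<Rightarrow> nat \<Rightarrow> nat \<Rightarrow> nat \<Rightarrow> nat \<Rightarrow> nat \<Rightarrow> nat \<Rightarrow> nat \<Rightarrow> real" where
  "tcol u1 w1 u2 w2 u3 w3 i j = 2 * (if i = 1 then 1 else 0) + 2 * prm u1 w1 1 u2 w2 1 u3 w3 i j - 1"

text \<open>
  The sign matrices below are the nine terms of explicit decompositions found by linear programming.
\<close>

lemma stab_row_row_id:
  assumes U: "{u1,u2,u3} = {2,3,4}" and W: "{w1,w2,w3} = {2,3,4}"
  shows "stab (\<lambda>i j. trow u1 w1 u2 w2 u3 w3 i j * trow u1 w1 u2 w2 u3 w3 i j)"
proof -
  \<comment> \<open>Every generator has entry 1 at \<open>(1,1)\<close>, whereas \<open>trow\<close>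
    and \<open>tcol\<close> have entry 3 there. Hence the weights in any decomposition of a product
    of two of them add up to nine; here they are integers and repeated terms carry
    multiplicities.\<close>
  have "stab (\<lambda>i j. blk u1 1 w1 1 i j + (blk u1 (-1) w2 (-1) i j + (blk u1 1 w3 1 i j + (blk u2 1 w3 1 i j + (blk u3 1 w2 1 i j + (blk u3 1 w2 1 i j + (blk u3 (-1) w3 (-1) i j + (prm u1 w3 (-1) u2 w1 1 u3 w2 i j + (prm u1 w3 1 u2 w2 1 u3 w1 i j)))))))))"
    by (intro stab.add stab.blk stab.prm) (use U W in \<open>auto simp: insert_commute\<close>)
  then show ?thesis
  proof (rule stab.cong)
    fix i j :: nat assume "i \<in> {1..4}" "j \<in> {1..4}"
    with enum_one[OF U] enum_one[OF W] have "i \<in> {1,u1,u2,u3}" "j \<in> {1,w1,w2,w3}" by simp_all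
    then show "blk u1 1 w1 1 i j + (blk u1 (-1) w2 (-1) i j + (blk u1 1 w3 1 i j + (blk u2 1 w3 1 i j + (blk u3 1 w2 1 i j + (blk u3 1 w2 1 i j + (blk u3 (-1) w3 (-1) i j + (prm u1 w3 (-1) u2 w1 1 u3 w2 i j + (prm u1 w3 1 u2 w2 1 u3 w1 i j)))))))) = trow u1 w1 u2 w2 u3 w3 i j * trow u1 w1 u2 w2 u3 w3 i j"
      using enum_distinct[OF enum_one[OF U]] enum_distinct[OF enum_one[OF W]]
      by (elim insertE emptyE) (simp_all add: blk_def prm_def trow_def tcol_def)
  qed
qed

lemma stab_row_row_swap:
  assumes U: "{u1,u2,u3} = {2,3,4}" and W: "{w1,w2,w3} = {2,3,4}"
  shows "stab (\<lambda>i j. trow u1 w1 u2 w2 u3 w3 i j * trow u1 w1 u2 w3 u3 w2 i j)"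
proof -
  have "stab (\<lambda>i j. blk u1 1 w3 1 i j + (blk u2 1 w2 1 i j + (blk u3 1 w1 1 i j + (prm u1 w1 1 u2 w2 (-1) u3 w3 i j + (prm u1 w1 1 u2 w2 (-1) u3 w3 i j + (prm u1 w1 1 u2 w3 (-1) u3 w2 i j + (prm u1 w1 (-1) u2 w3 1 u3 w2 i j + (prm u1 w1 (-1) u2 w3 (-1) u3 w2 i j + (prm u1 w2 1 u2 w1 1 u3 w3 i j)))))))))"
    by (intro stab.add stab.blk stab.prm) (use U W in \<open>auto simp: insert_commute\<close>)
  then show ?thesis
  proof (rule stab.cong)
    fix i j :: nat assume "i \<in> {1..4}" "j \<in> {1..4}"
    with enum_one[OF U] enum_one[OF W] have "i \<in> {1,u1,u2,u3}" "j \<in> {1,w1,w2,w3}" by simp_all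
    then show "blk u1 1 w3 1 i j + (blk u2 1 w2 1 i j + (blk u3 1 w1 1 i j + (prm u1 w1 1 u2 w2 (-1) u3 w3 i j + (prm u1 w1 1 u2 w2 (-1) u3 w3 i j + (prm u1 w1 1 u2 w3 (-1) u3 w2 i j + (prm u1 w1 (-1) u2 w3 1 u3 w2 i j + (prm u1 w1 (-1) u2 w3 (-1) u3 w2 i j + (prm u1 w2 1 u2 w1 1 u3 w3 i j)))))))) = trow u1 w1 u2 w2 u3 w3 i j * trow u1 w1 u2 w3 u3 w2 i j"
      using enum_distinct[OF enum_one[OF U]] enum_distinct[OF enum_one[OF W]]
      by (elim insertE emptyE) (simp_all add: blk_def prm_def trow_def tcol_def)
  qed
qed

lemma stab_row_row_cycle:
  assumes U: "{u1,u2,u3} = {2,3,4}" and W: "{w1,w2,w3} = {2,3,4}"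
  shows "stab (\<lambda>i j. trow u1 w1 u2 w2 u3 w3 i j * trow u1 w2 u2 w3 u3 w1 i j)"
proof -
  have "stab (\<lambda>i j. blk u1 1 w1 (-1) i j + (blk u2 1 w1 1 i j + (blk u3 (-1) w1 1 i j + (blk u3 1 w2 1 i j + (blk u3 1 w2 1 i j + (blk u3 1 w2 (-1) i j + (blk u3 (-1) w3 1 i j + (prm u1 w2 (-1) u2 w3 (-1) u3 w1 i j + (prm u1 w3 1 u2 w2 (-1) u3 w1 i j)))))))))"
    by (intro stab.add stab.blk stab.prm) (use U W in \<open>auto simp: insert_commute\<close>)
  then show ?thesis
  proof (rule stab.cong)
    fix i j :: nat assume "i \<in> {1..4}" "j \<in> {1..4}"
    with enum_one[OF U] enum_one[OF W] have "i \<in> {1,u1,u2,u3}" "j \<in> {1,w1,w2,w3}" by simp_all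
    then show "blk u1 1 w1 (-1) i j + (blk u2 1 w1 1 i j + (blk u3 (-1) w1 1 i j + (blk u3 1 w2 1 i j + (blk u3 1 w2 1 i j + (blk u3 1 w2 (-1) i j + (blk u3 (-1) w3 1 i j + (prm u1 w2 (-1) u2 w3 (-1) u3 w1 i j + (prm u1 w3 1 u2 w2 (-1) u3 w1 i j)))))))) = trow u1 w1 u2 w2 u3 w3 i j * trow u1 w2 u2 w3 u3 w1 i j"
      using enum_distinct[OF enum_one[OF U]] enum_distinct[OF enum_one[OF W]]
      by (elim insertE emptyE) (simp_all add: blk_def prm_def trow_def tcol_def)
  qed
qed

lemma stab_row_col_id:
  assumes U: "{u1,u2,u3} = {2,3,4}" and W: "{w1,w2,w3} = {2,3,4}"
  shows "stab (\<lambda>i j. trow u1 w1 u2 w2 u3 w3 i j * tcol u1 w1 u2 w2 u3 w3 i j)"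
proof -
  have "stab (\<lambda>i j. blk u1 (-1) w1 (-1) i j + (blk u1 (-1) w1 (-1) i j + (blk u1 1 w2 (-1) i j + (blk u2 (-1) w3 (-1) i j + (blk u3 (-1) w1 1 i j + (prm u1 w1 (-1) u2 w3 (-1) u3 w2 i j + (prm u1 w2 1 u2 w1 1 u3 w3 i j + (prm u1 w2 1 u2 w3 1 u3 w1 i j + (prm u1 w3 1 u2 w2 1 u3 w1 i j)))))))))"
    by (intro stab.add stab.blk stab.prm) (use U W in \<open>auto simp: insert_commute\<close>)
  then show ?thesis
  proof (rule stab.cong)
    fix i j :: nat assume "i \<in> {1..4}" "j \<in> {1..4}"
    with enum_one[OF U] enum_one[OF W] have "i \<in> {1,u1,u2,u3}" "j \<in> {1,w1,w2,w3}" by simp_all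
    then show "blk u1 (-1) w1 (-1) i j + (blk u1 (-1) w1 (-1) i j + (blk u1 1 w2 (-1) i j + (blk u2 (-1) w3 (-1) i j + (blk u3 (-1) w1 1 i j + (prm u1 w1 (-1) u2 w3 (-1) u3 w2 i j + (prm u1 w2 1 u2 w1 1 u3 w3 i j + (prm u1 w2 1 u2 w3 1 u3 w1 i j + (prm u1 w3 1 u2 w2 1 u3 w1 i j)))))))) = trow u1 w1 u2 w2 u3 w3 i j * tcol u1 w1 u2 w2 u3 w3 i j"
      using enum_distinct[OF enum_one[OF U]] enum_distinct[OF enum_one[OF W]]
      by (elim insertE emptyE) (simp_all add: blk_def prm_def trow_def tcol_def)
  qed
qed

lemma stab_row_col_swap:
  assumes U: "{u1,u2,u3} = {2,3,4}" and W: "{w1,w2,w3} = {2,3,4}"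
  shows "stab (\<lambda>i j. trow u1 w1 u2 w2 u3 w3 i j * tcol u1 w1 u2 w3 u3 w2 i j)"
proof -
  have "stab (\<lambda>i j. blk u1 1 w1 1 i j + (blk u1 (-1) w3 (-1) i j + (blk u1 (-1) w3 (-1) i j + (blk u2 (-1) w1 (-1) i j + (blk u3 (-1) w1 (-1) i j + (blk u3 1 w2 (-1) i j + (blk u3 (-1) w3 1 i j + (prm u1 w2 1 u2 w3 (-1) u3 w1 i j + (prm u1 w3 (-1) u2 w2 (-1) u3 w1 i j)))))))))"
    by (intro stab.add stab.blk stab.prm) (use U W in \<open>auto simp: insert_commute\<close>)
  then show ?thesis
  proof (rule stab.cong)
    fix i j :: nat assume "i \<in> {1..4}" "j \<in> {1..4}"
    with enum_one[OF U] enum_one[OF W] have "i \<in> {1,u1,u2,u3}" "j \<in> {1,w1,w2,w3}" by simp_all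
    then show "blk u1 1 w1 1 i j + (blk u1 (-1) w3 (-1) i j + (blk u1 (-1) w3 (-1) i j + (blk u2 (-1) w1 (-1) i j + (blk u3 (-1) w1 (-1) i j + (blk u3 1 w2 (-1) i j + (blk u3 (-1) w3 1 i j + (prm u1 w2 1 u2 w3 (-1) u3 w1 i j + (prm u1 w3 (-1) u2 w2 (-1) u3 w1 i j)))))))) = trow u1 w1 u2 w2 u3 w3 i j * tcol u1 w1 u2 w3 u3 w2 i j"
      using enum_distinct[OF enum_one[OF U]] enum_distinct[OF enum_one[OF W]]
      by (elim insertE emptyE) (simp_all add: blk_def prm_def trow_def tcol_def)
  qed
qed

lemma stab_row_col_cycle:
  assumes U: "{u1,u2,u3} = {2,3,4}" and W: "{w1,w2,w3} = {2,3,4}"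
  shows "stab (\<lambda>i j. trow u1 w1 u2 w2 u3 w3 i j * tcol u1 w2 u2 w3 u3 w1 i j)"
proof -
  have "stab (\<lambda>i j. blk u1 (-1) w2 1 i j + (blk u2 (-1) w1 (-1) i j + (blk u3 (-1) w2 (-1) i j + (blk u3 (-1) w2 (-1) i j + (blk u3 1 w3 (-1) i j + (prm u1 w1 1 u2 w3 (-1) u3 w2 i j + (prm u1 w1 (-1) u2 w3 1 u3 w2 i j + (prm u1 w1 (-1) u2 w3 (-1) u3 w2 i j + (prm u1 w3 1 u2 w2 (-1) u3 w1 i j)))))))))"
    by (intro stab.add stab.blk stab.prm) (use U W in \<open>auto simp: insert_commute\<close>)
  then show ?thesis
  proof (rule stab.cong)
    fix i j :: nat assume "i \<in> {1..4}" "j \<in> {1..4}"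
    with enum_one[OF U] enum_one[OF W] have "i \<in> {1,u1,u2,u3}" "j \<in> {1,w1,w2,w3}" by simp_all
    then show "blk u1 (-1) w2 1 i j + (blk u2 (-1) w1 (-1) i j + (blk u3 (-1) w2 (-1) i j + (blk u3 (-1) w2 (-1) i j + (blk u3 1 w3 (-1) i j + (prm u1 w1 1 u2 w3 (-1) u3 w2 i j + (prm u1 w1 (-1) u2 w3 1 u3 w2 i j + (prm u1 w1 (-1) u2 w3 (-1) u3 w2 i j + (prm u1 w3 1 u2 w2 (-1) u3 w1 i j)))))))) = trow u1 w1 u2 w2 u3 w3 i j * tcol u1 w2 u2 w3 u3 w1 i j"
      using enum_distinct[OF enum_one[OF U]] enum_distinct[OF enum_one[OF W]]
      by (elim insertE emptyE) (simp_all add: blk_def prm_def trow_def tcol_def)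
  qed
qed

section \<open>Products of two rays outside the commuting sets\<close>

inductive residual :: "(nat \<Rightarrow> nat \<Rightarrow> real) \<Rightarrow> bool" where
  row: "{u1,u2,u3} = {2,3,4} \<Longrightarrow> {w1,w2,w3} = {2,3,4} \<Longrightarrow> residual (trow u1 w1 u2 w2 u3 w3)"
| col: "{u1,u2,u3} = {2,3,4} \<Longrightarrow> {w1,w2,w3} = {2,3,4} \<Longrightarrow> residual (tcol u1 w1 u2 w2 u3 w3)"

lemma prm_fun:
  "prm u1 (f u1) 1 u2 (f u2) 1 u3 (f u3) i j =
    (if i = 1 then of_bool (j = 1) else if i \<in> {u1,u2,u3} then of_bool (j = f i) else 0)"
  by (auto simp: prm_def)

text \<open>Rewriting both factors over the same arrangement of row indices leaves a single datum
  for the pair: the relative permutation of the column indices.\<close>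

lemma prm_reorder:
  assumes U: "{u1,u2,u3} = {2,3,4::nat}" and V: "{v1,v2,v3} = {2,3,4}" and W: "{w1,w2,w3} = {2,3,4}"
  obtains x1 x2 x3 where "{x1,x2,x3} = {2,3,4}"
    "prm v1 w1 1 v2 w2 1 v3 w3 = prm u1 x1 1 u2 x2 1 u3 x3"
proof -
  define f where "f = (\<lambda>x. if x = v1 then w1 else if x = v2 then w2 else w3)"
  note d = enum_distinct[OF enum_one[OF V]]
  have f: "f v1 = w1" "f v2 = w2" "f v3 = w3" using d by (auto simp: f_def)
  have "{f u1, f u2, f u3} = f ` {2,3,4}" unfolding U[symmetric] by simp
  also have "\<dots> = {w1,w2,w3}" unfolding V[symmetric] using f by simp
  finally have "{f u1, f u2, f u3} = {2,3,4}" using W by simp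
  moreover have "prm v1 (f v1) 1 v2 (f v2) 1 v3 (f v3) = prm u1 (f u1) 1 u2 (f u2) 1 u3 (f u3)"
    by (intro ext) (simp only: prm_fun U V)
  ultimately show thesis using that f by simp
qed

lemma prm_swap:
  assumes "{u1,u2,u3} = {2,3,4::nat}"
  shows "prm u2 w2 1 u1 w1 1 u3 w3 = prm u1 w1 1 u2 w2 1 u3 w3"
  using enum_distinct[OF enum_one[OF assms]] by (intro ext) (simp add: prm_def)

lemma prm_rotate:
  assumes "{u1,u2,u3} = {2,3,4::nat}"
  shows "prm u3 w3 1 u1 w1 1 u2 w2 = prm u1 w1 1 u2 w2 1 u3 w3"
  using enum_distinct[OF enum_one[OF assms]] by (intro ext) (simp add: prm_def)

text \<open>Renaming the pairs \<open>(u, w)\<close> simultaneously conjugates the relative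
  permutation. Thus one decomposition for each conjugacy class of permutations of three letters
  suffices: the identity, a transposition and a 3-cycle, whose inverse is conjugate to it by a
  transposition.\<close>

lemma stab_row_residual:
  assumes U: "{u1,u2,u3} = {2,3,4}" and W: "{w1,w2,w3} = {2,3,4}" and V: "{v1,v2,v3} = {2,3,4}"
    and T: "T = trow \<or> T = tcol"
  shows "stab (\<lambda>i j. trow u1 w1 u2 w2 u3 w3 i j * T u1 v1 u2 v2 u3 v3 i j)"
proof -
  have U': "{u2,u1,u3} = {2,3,4}" "{u3,u1,u2} = {2,3,4}" using U by (simp_all add: insert_commute)
  have W': "{w2,w1,w3} = {2,3,4}" "{w3,w1,w2} = {2,3,4}" using W by (simp_all add: insert_commute)
  have id: "stab (\<lambda>i j. trow u1 w1 u2 w2 u3 w3 i j * T u1 w1 u2 w2 u3 w3 i j)"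
    and swap: "stab (\<lambda>i j. trow u1 w1 u2 w2 u3 w3 i j * T u1 w1 u2 w3 u3 w2 i j)"
    and cycle: "stab (\<lambda>i j. trow u1 w1 u2 w2 u3 w3 i j * T u1 w2 u2 w3 u3 w1 i j)"
    if "{u1,u2,u3} = {2,3,4}" "{w1,w2,w3} = {2,3,4}" for u1 u2 u3 w1 w2 w3
    using T stab_row_row_id[OF that] stab_row_col_id[OF that] stab_row_row_swap[OF that]
      stab_row_col_swap[OF that] stab_row_row_cycle[OF that] stab_row_col_cycle[OF that] by (elim disjE; simp)+
  have row_swap: "trow u2 a2 u1 a1 u3 a3 = trow u1 a1 u2 a2 u3 a3"
    and col_swap: "tcol u2 a2 u1 a1 u3 a3 = tcol u1 a1 u2 a2 u3 a3" for a1 a2 a3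
    by (intro ext, simp only: trow_def tcol_def prm_swap[OF U])+
  have row_rotate: "trow u3 a3 u1 a1 u2 a2 = trow u1 a1 u2 a2 u3 a3"
    and col_rotate: "tcol u3 a3 u1 a1 u2 a2 = tcol u1 a1 u2 a2 u3 a3" for a1 a2 a3
    by (intro ext, simp only: trow_def tcol_def prm_rotate[OF U])+
  have T_swap: "T u2 a2 u1 a1 u3 a3 = T u1 a1 u2 a2 u3 a3" for a1 a2 a3
    using T by (elim disjE) (simp_all only: row_swap col_swap)
  have T_rotate: "T u3 a3 u1 a1 u2 a2 = T u1 a1 u2 a2 u3 a3" for a1 a2 a3
    using T by (elim disjE) (simp_all only: row_rotate col_rotate)
  have "v1 \<in> {w1,w2,w3}" "v2 \<in> {w1,w2,w3}" "v3 \<in> {w1,w2,w3}" unfolding W V[symmetric] by simp_all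
  then have "v1 = w1 \<and> v2 = w2 \<and> v3 = w3 \<or> v1 = w1 \<and> v2 = w3 \<and> v3 = w2
    \<or> v1 = w2 \<and> v2 = w3 \<and> v3 = w1 \<or> v1 = w3 \<and> v2 = w1 \<and> v3 = w2
    \<or> v1 = w3 \<and> v2 = w2 \<and> v3 = w1 \<or> v1 = w2 \<and> v2 = w1 \<and> v3 = w3"
    using enum_distinct(4-6)[OF enum_one[OF V]] by (elim insertE emptyE; simp)
  then consider "v1 = w1" "v2 = w2" "v3 = w3" | "v1 = w1" "v2 = w3" "v3 = w2"
    | "v1 = w2" "v2 = w3" "v3 = w1" | "v1 = w3" "v2 = w1" "v3 = w2"
    | "v1 = w3" "v2 = w2" "v3 = w1" | "v1 = w2" "v2 = w1" "v3 = w3"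
    by (elim disjE conjE)
  then show ?thesis
  proof cases
    case 1 then show ?thesis using id[OF U W] by simp
  next
    case 2 then show ?thesis using swap[OF U W] by simp
  next
    case 3 then show ?thesis using cycle[OF U W] by simp
  next
    case 4 then show ?thesis using cycle[OF U'(1) W'(1)] unfolding T_swap row_swap by simp
  next
    case 5 then show ?thesis using swap[OF U'(1) W'(1)] unfolding T_swap row_swap by simp
  next
    case 6 then show ?thesis using swap[OF U'(2) W'(2)] unfolding T_rotate row_rotate by simp
  qed
qed

lemma residual_mult:
  assumes "residual \<mu>" "residual \<nu>"
  shows "stab (\<lambda>i j. \<mu> i j * \<nu> i j)"
proof -
  obtain u1 u2 u3 w1 w2 w3 where U: "{u1,u2,u3} = {2,3,4}" and W: "{w1,w2,w3} = {2,3,4}"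
    and mu: "\<mu> = trow u1 w1 u2 w2 u3 w3 \<or> \<mu> = tcol u1 w1 u2 w2 u3 w3"
    using assms(1) by (cases rule: residual.cases) metis+
  obtain v1 v2 v3 y1 y2 y3 where V: "{v1,v2,v3} = {2,3,4}" and Y: "{y1,y2,y3} = {2,3,4}"
    and nu': "\<nu> = trow v1 y1 v2 y2 v3 y3 \<or> \<nu> = tcol v1 y1 v2 y2 v3 y3"
    using assms(2) by (cases rule: residual.cases) metis+
  obtain x1 x2 x3 where X: "{x1,x2,x3} = {2,3,4}"
    and eq: "prm v1 y1 1 v2 y2 1 v3 y3 = prm u1 x1 1 u2 x2 1 u3 x3"
    using prm_reorder[OF U V Y] by blast
  have "trow v1 y1 v2 y2 v3 y3 = trow u1 x1 u2 x2 u3 x3" "tcol v1 y1 v2 y2 v3 y3 = tcol u1 x1 u2 x2 u3 x3"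
    by (intro ext, simp only: trow_def tcol_def eq)+
  then have nu: "\<nu> = trow u1 x1 u2 x2 u3 x3 \<or> \<nu> = tcol u1 x1 u2 x2 u3 x3"
    using nu' by simp
  consider "\<mu> = trow u1 w1 u2 w2 u3 w3"
    | "\<mu> = tcol u1 w1 u2 w2 u3 w3" "\<nu> = trow u1 x1 u2 x2 u3 x3"
    | "\<mu> = tcol u1 w1 u2 w2 u3 w3" "\<nu> = tcol u1 x1 u2 x2 u3 x3"
    using mu nu by blast
  then show ?thesis
  proof cases
    case 1
    then show ?thesis using nu stab_row_residual[OF U W X, of trow] stab_row_residual[OF U W X, of tcol] by (elim disjE) simp_all
  next
    case 2
    then show ?thesis using stab_row_residual[OF U X W, of tcol] by (simp add: mult.commute)
  next
    case 3
    \<comment> \<open>On the indices \<open>1..4\<close>, \<open>trow\<close> and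
      \<open>tcol\<close> differ only by a sign at the entries with exactly one index equal to 1.
      The sign cancels in a product of two factors of the same kind.\<close>
    have "stab (\<lambda>i j. trow u1 w1 u2 w2 u3 w3 i j * trow u1 x1 u2 x2 u3 x3 i j)"
      using stab_row_residual[OF U W X, of trow] by simp
    then show ?thesis
    proof (rule stab.cong)
      fix i j :: nat assume "i \<in> {1..4}" "j \<in> {1..4}"
      with enum_one[OF U] enum_one[OF W] have "i \<in> {1,u1,u2,u3}" "j \<in> {1,w1,w2,w3}" by simp_all
      then show "trow u1 w1 u2 w2 u3 w3 i j * trow u1 x1 u2 x2 u3 x3 i j = \<mu> i j * \<nu> i j"
        using enum_distinct[OF enum_one[OF U]] enum_distinct[OF enum_one[OF W]] enum_distinct[OF enum_one[OF X]]
        unfolding 3 by (elim insertE emptyE) (simp_all add: prm_def trow_def tcol_def)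
    qed
  qed
qed

section \<open>Fourier transforms of the rays\<close>

lemma enum_translate:
  assumes "{a,b,c,d} = {1..4::nat}"
  obtains u v w where "{u,v,w} = {2,3,4}"
    "\<forall>i\<in>{1..4}. chr b i = chr a i * chr u i"
    "\<forall>i\<in>{1..4}. chr c i = chr a i * chr v i"
    "\<forall>i\<in>{1..4}. chr d i = chr a i * chr w i"
proof -
  \<comment> \<open>This is multiplication by \<open>a\<close> in the Klein four-group. The product
    of two distinct elements of \<open>{2,3,4}\<close> is the remaining one, and
    \<open>2 + 3 + 4 = 9\<close>. So \<open>q\<close> translates \<open>a\<close> out of the other
    three indices, leaving the character of \<open>a\<close> as a common factor.\<close>
  define q where "q = (\<lambda>x. if a = 1 then x else if x = 1 then a else 9 - a - x)"
  have I: "{1..4} = {1,2,3,4::nat}" by auto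
  have abcd: "a \<in> {1,2,3,4}" "b \<in> {1,2,3,4}" "c \<in> {1,2,3,4}" "d \<in> {1,2,3,4}"
    unfolding I[symmetric] assms[symmetric] by simp_all
  note ne = enum_distinct[OF assms]
  have chr_q: "chr x i = chr a i * chr (q x) i" if "x \<in> {1,2,3,4}" "x \<noteq> a" "i \<in> {1..4}" for x i
    using that abcd(1) unfolding I q_def by (elim insertE emptyE) (simp_all add: chr_def)
  have "q x \<in> {2,3,4}" if "x \<in> {1,2,3,4}" "x \<noteq> a" for x
    using that abcd(1) unfolding q_def by (elim insertE emptyE) simp_all
  then have "{q b, q c, q d} \<subseteq> {2,3,4}" using abcd ne by simp
  moreover have "q x \<noteq> q y" if "x \<in> {1,2,3,4}" "y \<in> {1,2,3,4}" "x \<noteq> y" "x \<noteq> a" "y \<noteq> a" for x y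
    using that abcd(1) unfolding q_def by (elim insertE emptyE) simp_all
  then have "card {q b, q c, q d} = 3" using abcd ne by simp
  ultimately have "{q b, q c, q d} = {2,3,4}" by (intro card_subset_eq) simp_all
  then show thesis
    by (rule that) (intro ballI chr_q abcd ne[symmetric]; assumption)+
qed

lemma pauli_ft_enum:
  assumes X: "{x0,x1,x2,x3} = {1..4}" and Y: "{y0,y1,y2,y3} = {1..4}"
  shows "pauli_ft p i j =
      chr x0 i * (chr y0 j * p x0 y0 + chr y1 j * p x0 y1 + chr y2 j * p x0 y2 + chr y3 j * p x0 y3)
    + chr x1 i * (chr y0 j * p x1 y0 + chr y1 j * p x1 y1 + chr y2 j * p x1 y2 + chr y3 j * p x1 y3)
    + chr x2 i * (chr y0 j * p x2 y0 + chr y1 j * p x2 y1 + chr y2 j * p x2 y2 + chr y3 j * p x2 y3)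
    + chr x3 i * (chr y0 j * p x3 y0 + chr y1 j * p x3 y1 + chr y2 j * p x3 y2 + chr y3 j * p x3 y3)"
proof -
  have "pauli_ft p i j = (\<Sum>r\<in>{1..4}. chr r i * (\<Sum>s\<in>{1..4}. chr s j * p r s))"
    unfolding pauli_ft_def sum_distrib_left
    by (intro sum.cong refl) (simp add: chr_commute[of i] chr_commute[of j] mult.assoc)
  then show ?thesis
    unfolding sum_enum[OF X, of "\<lambda>r. chr r i * (\<Sum>s\<in>{1..4}. chr s j * p r s)"] unfolding sum_enum[OF Y] .
qed

lemma chr_sum:
  assumes "{w1,w2,w3} = {2,3,4}" "j \<in> {1..4}"
  shows "chr w1 j + chr w2 j + chr w3 j = 4 * (if j = 1 then 1 else 0) - 1"
proof -
  have "j \<in> {1,w1,w2,w3}" using assms enum_one by simp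
  then show ?thesis
    using enum_distinct[OF enum_one[OF assms(1)]] by (elim insertE emptyE) (simp_all add: chr_def)
qed

text \<open>Every permutation of the Klein four-group that fixes the identity is an automorphism and
  preserves \<open>chr\<close>. Adding the trivial term 1 on the left turns the identity into
  character orthogonality on its graph.\<close>

lemma chr_prm:
  assumes U: "{u1,u2,u3} = {2,3,4}" and W: "{w1,w2,w3} = {2,3,4}" and "i \<in> {1..4}" "j \<in> {1..4}"
  shows "chr u1 i * chr w1 j + chr u2 i * chr w2 j + chr u3 i * chr w3 j = 4 * prm u1 w1 1 u2 w2 1 u3 w3 i j - 1"
proof -
  have "i \<in> {1,u1,u2,u3}" "j \<in> {1,w1,w2,w3}" using assms enum_one by simp_all
  then show ?thesis
    using enum_distinct[OF enum_one[OF U]] enum_distinct[OF enum_one[OF W]]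
    by (elim insertE emptyE) (simp_all add: chr_def prm_def)
qed

lemma chr_blk:
  assumes U: "{u1,u2,u3} = {2,3,4}" and W: "{w1,w2,w3} = {2,3,4}" and "i \<in> {1..4}" "j \<in> {1..4}"
  shows "(1 + chr u1 i) * (1 + chr w1 j) = 4 * blk u1 1 w1 1 i j"
proof -
  have "i \<in> {1,u1,u2,u3}" "j \<in> {1,w1,w2,w3}" using assms enum_one by simp_all
  then show ?thesis
    using enum_distinct[OF enum_one[OF U]] enum_distinct[OF enum_one[OF W]]
    by (elim insertE emptyE) (simp_all add: chr_def blk_def)
qed

text \<open>The twist comes from translating the point \<open>(a, a')\<close> to
  \<open>(1, 1)\<close>. For permutations and blocks this point lies in the support; for the other
  two shapes it is the point left out of the row or column. Character orthogonality evaluates the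
  translated sums.\<close>

lemma pauli_ft_ray:
  assumes "(S, T) \<in> rays"
  obtains r c k \<nu> where "r \<in> {1..4}" "c \<in> {1..4}" "0 \<le> k" "stab \<nu> \<or> residual \<nu>"
    "\<forall>i\<in>{1..4}. \<forall>j\<in>{1..4}. pauli_ft (ind S) i j = k * (chr r i * chr c j * \<nu> i j)"
  using assms
proof (cases rule: rays.cases)
  case (perm a b c d a' b' c' d')
  note X = perm(3) and Y = perm(4)
  note d = enum_distinct[OF X] enum_distinct[OF Y]
  obtain u1 u2 u3 where U: "{u1,u2,u3} = {2,3,4}" and u: "\<forall>i\<in>{1..4}. chr b i = chr a i * chr u1 i"
    "\<forall>i\<in>{1..4}. chr c i = chr a i * chr u2 i" "\<forall>i\<in>{1..4}. chr d i = chr a i * chr u3 i"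
    by (rule enum_translate[OF X])
  obtain w1 w2 w3 where W: "{w1,w2,w3} = {2,3,4}" and w: "\<forall>i\<in>{1..4}. chr b' i = chr a' i * chr w1 i"
    "\<forall>i\<in>{1..4}. chr c' i = chr a' i * chr w2 i" "\<forall>i\<in>{1..4}. chr d' i = chr a' i * chr w3 i"
    by (rule enum_translate[OF Y])
  have "stab (prm u1 w1 1 u2 w2 1 u3 w3)" by (rule stab.prm[OF U W]) simp_all
  moreover have "a \<in> {1..4}" unfolding X[symmetric] by simp
  moreover have "a' \<in> {1..4}" unfolding Y[symmetric] by simp
  moreover have "pauli_ft (ind S) i j = 4 * (chr a i * chr a' j * prm u1 w1 1 u2 w2 1 u3 w3 i j)"
    if "i \<in> {1..4}" "j \<in> {1..4}" for i j
  proof -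
    have "pauli_ft (ind S) i j = chr a i * chr a' j + chr b i * chr b' j + chr c i * chr c' j + chr d i * chr d' j"
      unfolding pauli_ft_enum[OF X Y] ind_def perm using d by simp
    also have "\<dots> = chr a i * chr a' j * (1 + (chr u1 i * chr w1 j + chr u2 i * chr w2 j + chr u3 i * chr w3 j))"
      unfolding u[rule_format, OF that(1)] w[rule_format, OF that(2)] by (simp add: algebra_simps)
    finally show ?thesis unfolding chr_prm[OF U W that] by simp
  qed
  ultimately show thesis using that[of a a' 4 "prm u1 w1 1 u2 w2 1 u3 w3"] by simp
next
  case (block a b c d a' b' c' d')
  note X = block(3) and Y = block(4)
  note d = enum_distinct[OF X] enum_distinct[OF Y]
  obtain u1 u2 u3 where U: "{u1,u2,u3} = {2,3,4}" and u: "\<forall>i\<in>{1..4}. chr b i = chr a i * chr u1 i"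
    "\<forall>i\<in>{1..4}. chr c i = chr a i * chr u2 i" "\<forall>i\<in>{1..4}. chr d i = chr a i * chr u3 i"
    by (rule enum_translate[OF X])
  obtain w1 w2 w3 where W: "{w1,w2,w3} = {2,3,4}" and w: "\<forall>i\<in>{1..4}. chr b' i = chr a' i * chr w1 i"
    "\<forall>i\<in>{1..4}. chr c' i = chr a' i * chr w2 i" "\<forall>i\<in>{1..4}. chr d' i = chr a' i * chr w3 i"
    by (rule enum_translate[OF Y])
  have "u1 \<in> {2,3,4}" unfolding U[symmetric] by simp
  moreover have "w1 \<in> {2,3,4}" unfolding W[symmetric] by simp
  ultimately have "stab (blk u1 1 w1 1)" by (intro stab.blk) simp_all
  moreover have "a \<in> {1..4}" unfolding X[symmetric] by simp
  moreover have "a' \<in> {1..4}" unfolding Y[symmetric] by simp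
  moreover have "pauli_ft (ind S) i j = 4 * (chr a i * chr a' j * blk u1 1 w1 1 i j)"
    if "i \<in> {1..4}" "j \<in> {1..4}" for i j
  proof -
    have "pauli_ft (ind S) i j = (chr a i + chr b i) * (chr a' j + chr b' j)"
      unfolding pauli_ft_enum[OF X Y] ind_def block using d by (simp add: algebra_simps)
    also have "\<dots> = chr a i * chr a' j * ((1 + chr u1 i) * (1 + chr w1 j))"
      unfolding u[rule_format, OF that(1)] w[rule_format, OF that(2)] by (simp add: algebra_simps)
    finally show ?thesis unfolding chr_blk[OF U W that] by simp
  qed
  ultimately show thesis using that[of a a' 4 "blk u1 1 w1 1"] by simp
next
  case (row a b c d a' b' c' d')
  note X = row(3) and Y = row(4)
  note d = enum_distinct[OF X] enum_distinct[OF Y]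
  obtain u1 u2 u3 where U: "{u1,u2,u3} = {2,3,4}" and u: "\<forall>i\<in>{1..4}. chr b i = chr a i * chr u1 i"
    "\<forall>i\<in>{1..4}. chr c i = chr a i * chr u2 i" "\<forall>i\<in>{1..4}. chr d i = chr a i * chr u3 i"
    by (rule enum_translate[OF X])
  obtain w1 w2 w3 where W: "{w1,w2,w3} = {2,3,4}" and w: "\<forall>i\<in>{1..4}. chr b' i = chr a' i * chr w1 i"
    "\<forall>i\<in>{1..4}. chr c' i = chr a' i * chr w2 i" "\<forall>i\<in>{1..4}. chr d' i = chr a' i * chr w3 i"
    by (rule enum_translate[OF Y])
  have "residual (trow u1 w1 u2 w2 u3 w3)" by (rule residual.row[OF U W])
  moreover have "a \<in> {1..4}" unfolding X[symmetric] by simp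
  moreover have "a' \<in> {1..4}" unfolding Y[symmetric] by simp
  moreover have "pauli_ft (ind S) i j = 2 * (chr a i * chr a' j * trow u1 w1 u2 w2 u3 w3 i j)"
    if "i \<in> {1..4}" "j \<in> {1..4}" for i j
  proof -
    have "pauli_ft (ind S) i j = chr a i * (chr b' j + chr c' j + chr d' j)
        + (chr b i * chr b' j + chr c i * chr c' j + chr d i * chr d' j)"
      unfolding pauli_ft_enum[OF X Y] ind_def row using d by (simp add: algebra_simps)
    also have "\<dots> = chr a i * chr a' j * ((chr w1 j + chr w2 j + chr w3 j)
        + (chr u1 i * chr w1 j + chr u2 i * chr w2 j + chr u3 i * chr w3 j))"
      unfolding u[rule_format, OF that(1)] w[rule_format, OF that(2)] by (simp add: algebra_simps)
    finally show ?thesis unfolding chr_prm[OF U W that] chr_sum[OF W that(2)] trow_def by (simp add: algebra_simps)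
  qed
  ultimately show thesis using that[of a a' 2 "trow u1 w1 u2 w2 u3 w3"] by simp
next
  case (col a b c d a' b' c' d')
  note X = col(3) and Y = col(4)
  note d = enum_distinct[OF X] enum_distinct[OF Y]
  obtain u1 u2 u3 where U: "{u1,u2,u3} = {2,3,4}" and u: "\<forall>i\<in>{1..4}. chr b i = chr a i * chr u1 i"
    "\<forall>i\<in>{1..4}. chr c i = chr a i * chr u2 i" "\<forall>i\<in>{1..4}. chr d i = chr a i * chr u3 i"
    by (rule enum_translate[OF X])
  obtain w1 w2 w3 where W: "{w1,w2,w3} = {2,3,4}" and w: "\<forall>i\<in>{1..4}. chr b' i = chr a' i * chr w1 i"
    "\<forall>i\<in>{1..4}. chr c' i = chr a' i * chr w2 i" "\<forall>i\<in>{1..4}. chr d' i = chr a' i * chr w3 i"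
    by (rule enum_translate[OF Y])
  have "residual (tcol u1 w1 u2 w2 u3 w3)" by (rule residual.col[OF U W])
  moreover have "a \<in> {1..4}" unfolding X[symmetric] by simp
  moreover have "a' \<in> {1..4}" unfolding Y[symmetric] by simp
  moreover have "pauli_ft (ind S) i j = 2 * (chr a i * chr a' j * tcol u1 w1 u2 w2 u3 w3 i j)"
    if "i \<in> {1..4}" "j \<in> {1..4}" for i j
  proof -
    have "pauli_ft (ind S) i j = chr a' j * (chr b i + chr c i + chr d i)
        + (chr b i * chr b' j + chr c i * chr c' j + chr d i * chr d' j)"
      unfolding pauli_ft_enum[OF X Y] ind_def col using d by (simp add: algebra_simps)
    also have "\<dots> = chr a i * chr a' j * ((chr u1 i + chr u2 i + chr u3 i)
        + (chr u1 i * chr w1 j + chr u2 i * chr w2 j + chr u3 i * chr w3 j))"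
      unfolding u[rule_format, OF that(1)] w[rule_format, OF that(2)] by (simp add: algebra_simps)
    finally show ?thesis unfolding chr_prm[OF U W that] chr_sum[OF U that(1)] tcol_def by (simp add: algebra_simps)
  qed
  ultimately show thesis using that[of a a' 2 "tcol u1 w1 u2 w2 u3 w3"] by simp
qed

lemma pauli_ft_cone: "pauli_ft (\<lambda>i j. p i j + c * q i j) r s = pauli_ft p r s + c * pauli_ft q r s"
  unfolding pauli_ft_def by (simp add: sum.distrib sum_distrib_left algebra_simps)

lemma pauli_ft_zero:
  assumes "\<And>i j. i \<in> {1..4} \<Longrightarrow> j \<in> {1..4} \<Longrightarrow> p i j = 0"
  shows "pauli_ft p r s = 0"
  unfolding pauli_ft_def using assms by (intro sum.neutral ballI) simp

lemma ind_nonneg: "0 \<le> ind S i j"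
  by (simp add: ind_def)

text \<open>The product is linear in each spectrum, so the cone is decomposed in one factor at a
  time. For two rays, either one of them is a twisted generator and absorbs the other, or both are
  residual and an explicit decomposition applies.\<close>

lemma stab_ray_mult:
  assumes "(S, T) \<in> rays" and q: "ppt q"
  shows "stab (\<lambda>i j. pauli_ft (ind S) i j * pauli_ft q i j)"
  using q
proof (induction q rule: ppt_induct)
  case (zero q)
  have "pauli_ft q i j = 0" for i j by (rule pauli_ft_zero) (rule zero)
  then show ?case using stab_zero by simp
next
  case (step q S' T' c)
  obtain r1 c1 k1 \<nu>1 where 1: "r1 \<in> {1..4}" "c1 \<in> {1..4}" "0 \<le> k1" "stab \<nu>1 \<or> residual \<nu>1"
    "\<forall>i\<in>{1..4}. \<forall>j\<in>{1..4}. pauli_ft (ind S) i j = k1 * (chr r1 i * chr c1 j * \<nu>1 i j)"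
    by (rule pauli_ft_ray[OF assms(1)])
  obtain r2 c2 k2 \<nu>2 where 2: "r2 \<in> {1..4}" "c2 \<in> {1..4}" "0 \<le> k2" "stab \<nu>2 \<or> residual \<nu>2"
    "\<forall>i\<in>{1..4}. \<forall>j\<in>{1..4}. pauli_ft (ind S') i j = k2 * (chr r2 i * chr c2 j * \<nu>2 i j)"
    by (rule pauli_ft_ray[OF step(1)])
  have "stab (\<lambda>i j. pauli_ft (ind S) i j * pauli_ft (ind S') i j)"
  proof -
    consider "stab \<nu>1" | "stab \<nu>2" | "residual \<nu>1" "residual \<nu>2" using 1(4) 2(4) by blast
    then show ?thesis
    proof cases
      case a: 1
      have "stab (\<lambda>i j. k1 * (chr r1 i * chr c1 j * \<nu>1 i j) * pauli_ft (ind S') i j)"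
        by (intro stab_mult_pauli_ft stab.scale stab_twist a 1(1-3) ind_nonneg)
      then show ?thesis by (rule stab.cong) (simp add: 1(5))
    next
      case a: 2
      have "stab (\<lambda>i j. k2 * (chr r2 i * chr c2 j * \<nu>2 i j) * pauli_ft (ind S) i j)"
        by (intro stab_mult_pauli_ft stab.scale stab_twist a 2(1-3) ind_nonneg)
      then show ?thesis by (rule stab.cong) (simp add: 2(5))
    next
      case 3
      have "stab (\<lambda>i j. (k1 * k2) * (chr r1 i * chr c1 j * (chr r2 i * chr c2 j * (\<nu>1 i j * \<nu>2 i j))))"
        using 1(1-3) 2(1-3) by (intro stab.scale stab_twist residual_mult 3) simp_all
      then show ?thesis by (rule stab.cong) (simp add: 1(5) 2(5))
    qed
  qed
  from stab.add[OF step(3) stab.scale[OF this step(2)]] show ?case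
    by (simp add: pauli_ft_cone algebra_simps)
qed

lemma stab_mult:
  assumes p: "ppt p" and q: "ppt q"
  shows "stab (\<lambda>i j. pauli_ft p i j * pauli_ft q i j)"
  using p
proof (induction p rule: ppt_induct)
  case (zero p)
  have "pauli_ft p i j = 0" for i j by (rule pauli_ft_zero) (rule zero)
  then show ?case using stab_zero by simp
next
  case (step p S T c)
  from stab.add[OF step(3) stab.scale[OF stab_ray_mult[OF step(1) q] step(2)]] show ?case
    by (simp add: pauli_ft_cone algebra_simps)
qed

section \<open>Choi matrices of Pauli diagonal maps\<close>

lemma sum_UNIV_prod: "(\<Sum>x\<in>UNIV. f x) = (\<Sum>a\<in>UNIV. \<Sum>b\<in>UNIV. f (a, b))"
  for f :: "'a::finite \<times> 'b::finite \<Rightarrow> 'c::comm_monoid_add"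
  by (simp add: sum.cartesian_product)

lemma cnonneg_norm: "cnonneg (cnj z * z)"
  by (simp add: cnonneg_def)

text \<open>Applying the amplification of \<open>L\<close> to the positive rank-one matrix of the
  maximally entangled vector yields the Choi matrix. Since amplifications use blocks numbered by
  naturals, the finite index type is numbered by a bijection \<open>h\<close>.\<close>

lemma psd_choi:
  fixes L :: "'i::finite cmat \<Rightarrow> 'j::finite cmat"
  assumes cp: "completely_positive L"
  shows "psd (choi L)"
proof -
  obtain h :: "'i \<Rightarrow> nat" where h: "bij_betw h UNIV {0..<card (UNIV :: 'i set)}"
    using ex_bij_betw_finite_nat[of "UNIV :: 'i set"] by auto
  define k where "k = card (UNIV :: 'i set)"
  have inj: "h a = h b \<longleftrightarrow> a = b" for a b
    using h by (auto simp: bij_betw_def inj_on_def)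
  have reindex: "(\<Sum>p<k. g p) = (\<Sum>c\<in>UNIV. g (h c))" for g :: "nat \<Rightarrow> complex"
    using sum.reindex_bij_betw[OF h, of g] by (simp add: k_def lessThan_atLeast0)
  \<comment> \<open>The matrix of the unnormalised maximally entangled vector, whose component at
    \<open>(p, a)\<close> is 1 if \<open>p = h a\<close> and 0 otherwise.\<close>
  define X :: "(nat \<times> 'i) cmat" where "X = (\<lambda>(p,a) (q,b). if p = h a \<and> q = h b then 1 else 0)"
  have "psd_blocks k X"
    unfolding psd_blocks_def
  proof
    fix v :: "nat \<times> 'i \<Rightarrow> complex"
    have "(\<Sum>p<k. \<Sum>q<k. \<Sum>a\<in>UNIV. \<Sum>b\<in>UNIV. cnj (v (p,a)) * X (p,a) (q,b) * v (q,b))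
      = (\<Sum>c\<in>UNIV. \<Sum>d\<in>UNIV. \<Sum>a\<in>UNIV. \<Sum>b\<in>UNIV.
          if d = b then if c = a then cnj (v (h c,a)) * v (h d,b) else 0 else 0)"
      unfolding reindex X_def by (intro sum.cong refl) (simp add: inj)
    also have "\<dots> = cnj (\<Sum>c\<in>UNIV. v (h c, c)) * (\<Sum>d\<in>UNIV. v (h d, d))"
      by (simp add: sum_product)
    finally show "cnonneg (\<Sum>p<k. \<Sum>q<k. \<Sum>a\<in>UNIV. \<Sum>b\<in>UNIV. cnj (v (p,a)) * X (p,a) (q,b) * v (q,b))"
      by (simp only: cnonneg_norm)
  qed
  then have pos: "psd_blocks k (ampl L X)" using cp unfolding completely_positive_def by blast
  have unit: "(\<lambda>a' b'. X (h c, a') (h d, b')) = unitm c d" for c d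
    by (auto simp: X_def unitm_def inj fun_eq_iff)
  show ?thesis
    unfolding psd_def
  proof
    fix v :: "'i \<times> 'j \<Rightarrow> complex"
    define v' where "v' = (\<lambda>(p,a). v (inv h p, a))"
    have v': "v' (h c, a) = v (c, a)" for c a
      using inj by (simp add: v'_def inv_f_f inj_def)
    have "(\<Sum>x\<in>UNIV. \<Sum>y\<in>UNIV. cnj (v x) * choi L x y * v y)
      = (\<Sum>c\<in>UNIV. \<Sum>a\<in>UNIV. \<Sum>d\<in>UNIV. \<Sum>b\<in>UNIV. cnj (v (c,a)) * L (unitm c d) a b * v (d,b))"
      unfolding sum_UNIV_prod choi_def by simp
    also have "\<dots> = (\<Sum>c\<in>UNIV. \<Sum>d\<in>UNIV. \<Sum>a\<in>UNIV. \<Sum>b\<in>UNIV. cnj (v (c,a)) * L (unitm c d) a b * v (d,b))"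
      by (intro sum.cong refl sum.swap)
    also have "\<dots> = (\<Sum>p<k. \<Sum>q<k. \<Sum>a\<in>UNIV. \<Sum>b\<in>UNIV. cnj (v' (p,a)) * ampl L X (p,a) (q,b) * v' (q,b))"
      unfolding reindex by (simp add: v' ampl_def unit)
    finally show "cnonneg (\<Sum>x\<in>UNIV. \<Sum>y\<in>UNIV. cnj (v x) * choi L x y * v y)"
      using pos unfolding psd_blocks_def by simp
  qed
qed

lemma trace_unitm: "trace (mmult A (unitm c d)) = A d c"
proof -
  have "trace (mmult A (unitm c d)) = (\<Sum>x\<in>UNIV. \<Sum>y\<in>UNIV. if y = c then if x = d then A x y else 0 else 0)"
    unfolding trace_def mmult_def unitm_def by (intro sum.cong refl) simp
  then show ?thesis by simp
qed

text \<open>The transpose in the first factor arises because the trace of \<open>A\<close> times the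
  matrix unit at \<open>(c, d)\<close> is the entry of \<open>A\<close> at
  \<open>(d, c)\<close>.\<close>

lemma choi_pauli_diag2:
  "choi (pauli_diag2 \<mu>) x y = (\<Sum>i\<in>{1..4}. \<Sum>j\<in>{1..4}. complex_of_real (\<mu> i j / 4)
     * kron (transp (kron (pauli i) (pauli j))) (kron (pauli i) (pauli j)) x y)"
proof -
  obtain c a d b where xy: "x = (c, a)" "y = (d, b)" by (metis surj_pair)
  show ?thesis
    unfolding xy choi_def pauli_diag2_def trace_unitm transp_def
    by (simp add: kron_def[of "\<lambda>a b. kron _ _ b a"] mult.assoc)
qed

lemma kron_alt: "kron A B x y = A (fst x) (fst y) * B (snd x) (snd y)"
  by (simp add: kron_def case_prod_beta)

lemma sum_pair_mult:
  "(\<Sum>x\<in>UNIV. f (fst x) * g (snd x)) = (\<Sum>a\<in>UNIV. f a) * (\<Sum>b\<in>UNIV. g b)"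
  for f :: "'a::finite \<Rightarrow> complex" and g :: "'b::finite \<Rightarrow> complex"
  unfolding sum_UNIV_prod by (simp add: sum_product)

lemma sum_pair_mult4:
  "(\<Sum>c\<in>UNIV. \<Sum>a\<in>UNIV. \<Sum>d\<in>UNIV. \<Sum>b\<in>UNIV. f (fst c) (fst a) (fst d) (fst b) * g (snd c) (snd a) (snd d) (snd b))
    = (\<Sum>c\<in>UNIV. \<Sum>a\<in>UNIV. \<Sum>d\<in>UNIV. \<Sum>b\<in>UNIV. f c a d b) * (\<Sum>c\<in>UNIV. \<Sum>a\<in>UNIV. \<Sum>d\<in>UNIV. \<Sum>b\<in>UNIV. g c a d b)"
  for f :: "'a::finite \<Rightarrow> 'a \<Rightarrow> 'a \<Rightarrow> 'a \<Rightarrow> complex" and g :: "'b::finite \<Rightarrow> 'b \<Rightarrow> 'b \<Rightarrow> 'b \<Rightarrow> complex"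
proof -
  have 1: "(\<Sum>b\<in>UNIV. f x1 x2 x3 (fst b) * g y1 y2 y3 (snd b)) = (\<Sum>b\<in>UNIV. f x1 x2 x3 b) * (\<Sum>b\<in>UNIV. g y1 y2 y3 b)"
    for x1 x2 x3 y1 y2 y3 by (rule sum_pair_mult)
  have 2: "(\<Sum>d\<in>UNIV. (\<Sum>b\<in>UNIV. f x1 x2 (fst d) b) * (\<Sum>b\<in>UNIV. g y1 y2 (snd d) b))
      = (\<Sum>d\<in>UNIV. \<Sum>b\<in>UNIV. f x1 x2 d b) * (\<Sum>d\<in>UNIV. \<Sum>b\<in>UNIV. g y1 y2 d b)"
    for x1 x2 y1 y2 by (rule sum_pair_mult)
  have 3: "(\<Sum>a\<in>UNIV. (\<Sum>d\<in>UNIV. \<Sum>b\<in>UNIV. f x1 (fst a) d b) * (\<Sum>d\<in>UNIV. \<Sum>b\<in>UNIV. g y1 (snd a) d b))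
      = (\<Sum>a\<in>UNIV. \<Sum>d\<in>UNIV. \<Sum>b\<in>UNIV. f x1 a d b) * (\<Sum>a\<in>UNIV. \<Sum>d\<in>UNIV. \<Sum>b\<in>UNIV. g y1 a d b)"
    for x1 y1 by (rule sum_pair_mult)
  show ?thesis unfolding 1 2 3 by (rule sum_pair_mult)
qed

text \<open>The sum is the trace of the product of the Pauli matrices \<open>r\<close>,
  \<open>i\<close>, \<open>r\<close>, \<open>i\<close>, in which commuting the middle pair costs the
  sign \<open>chr r i\<close> and leaves the identity of trace 2.\<close>

lemma pauli_conj_sum:
  assumes "r \<in> {1..4}" "i \<in> {1..4}"
  shows "(\<Sum>c\<in>UNIV. \<Sum>a\<in>UNIV. \<Sum>d\<in>UNIV. \<Sum>b\<in>UNIV. cnj (pauli r a c) * pauli i d c * pauli i a b * pauli r b d)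
    = 2 * complex_of_real (chr r i)"
proof -
  have I: "{1..4} = {1,2,3,4::nat}" by auto
  show ?thesis
    using assms unfolding I UNIV_bool
    by (elim insertE emptyE) (simp_all add: pauli_def chr_def)
qed

text \<open>The vector \<open>v\<close> is a vectorised Pauli product, an unnormalised maximally
  entangled eigenvector of the Choi matrix. Its squared norm is 4, so the form is four times the
  eigenvalue.\<close>

lemma choi_pauli_form:
  assumes "r \<in> {1..4}" "s \<in> {1..4}"
  defines "v \<equiv> \<lambda>(c, a). kron (pauli r) (pauli s) a c"
  shows "(\<Sum>x\<in>UNIV. \<Sum>y\<in>UNIV. cnj (v x) * choi (pauli_diag2 \<mu>) x y * v y) = complex_of_real (pauli_ft \<mu> r s)"
proof -
  let ?t = "\<lambda>i j x y. kron (transp (kron (pauli i) (pauli j))) (kron (pauli i) (pauli j)) x y"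
  have form: "(\<Sum>x\<in>UNIV. \<Sum>y\<in>UNIV. cnj (v x) * ?t i j x y * v y) = 4 * complex_of_real (chr r i * chr s j)"
    if "i \<in> {1..4}" "j \<in> {1..4}" for i j
  proof -
    let ?f = "\<lambda>r i c a d b. cnj (pauli r a c) * pauli i d c * pauli i a b * pauli r b d"
    have "(\<Sum>x\<in>UNIV. \<Sum>y\<in>UNIV. cnj (v x) * ?t i j x y * v y)
      = (\<Sum>c\<in>UNIV. \<Sum>a\<in>UNIV. \<Sum>d\<in>UNIV. \<Sum>b\<in>UNIV. ?f r i (fst c) (fst a) (fst d) (fst b) * ?f s j (snd c) (snd a) (snd d) (snd b))"
      unfolding sum_UNIV_prod[where 'a = "bool \<times> bool" and 'b = "bool \<times> bool"] v_def
      by (intro sum.cong refl) (simp add: kron_alt transp_def)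
    also have "\<dots> = (2 * complex_of_real (chr r i)) * (2 * complex_of_real (chr s j))"
      unfolding sum_pair_mult4[of "?f r i" "?f s j"] using assms(1,2) that by (simp only: pauli_conj_sum)
    finally show ?thesis by simp
  qed
  have "(\<Sum>x\<in>UNIV. \<Sum>y\<in>UNIV. cnj (v x) * choi (pauli_diag2 \<mu>) x y * v y)
    = (\<Sum>x\<in>UNIV. \<Sum>y\<in>UNIV. \<Sum>i\<in>{1..4}. \<Sum>j\<in>{1..4}. complex_of_real (\<mu> i j / 4) * (cnj (v x) * ?t i j x y * v y))"
    unfolding choi_pauli_diag2 sum_distrib_left sum_distrib_right by (intro sum.cong refl) (simp only: ac_simps)
  also have "\<dots> = (\<Sum>i\<in>{1..4}. \<Sum>j\<in>{1..4}. complex_of_real (\<mu> i j / 4) * (\<Sum>x\<in>UNIV. \<Sum>y\<in>UNIV. cnj (v x) * ?t i j x y * v y))"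
    unfolding sum_idx by (simp only: sum.distrib sum_distrib_left)
  also have "\<dots> = (\<Sum>i\<in>{1..4}. \<Sum>j\<in>{1..4}. complex_of_real (chr r i * chr s j * \<mu> i j))"
    by (intro sum.cong refl) (simp add: form)
  finally show ?thesis by (simp add: pauli_ft_def)
qed

section \<open>Spectral conditions for complete positivity and copositivity\<close>

lemma pauli_ft_nonneg:
  assumes "completely_positive (pauli_diag2 \<mu>)" "r \<in> {1..4}" "s \<in> {1..4}"
  shows "0 \<le> pauli_ft \<mu> r s"
proof -
  have "cnonneg (complex_of_real (pauli_ft \<mu> r s))"
    unfolding choi_pauli_form[OF assms(2,3), symmetric]
    by (rule psd_choi[OF assms(1), unfolded psd_def, rule_format])
  then show ?thesis by (simp add: cnonneg_def)
qed

lemma transp_pauli_diag2: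
  "transp \<circ> pauli_diag2 \<mu> = pauli_diag2 (\<lambda>i j. (if i = 4 then -1 else 1) * (if j = 4 then -1 else 1) * \<mu> i j)"
proof -
  have p: "pauli i b a = (if i = 4 then -1 else 1) * pauli i a b" for i a b
    by (auto simp: pauli_def)
  have k: "kron (pauli i) (pauli j) y x = (if i = 4 then -1 else 1) * (if j = 4 then -1 else 1) * kron (pauli i) (pauli j) x y" for i j x y
    unfolding kron_alt p[of i "fst y"] p[of j "snd y"] by (simp only: ac_simps)
  have c: "complex_of_real (a * m / 4) * t * z = complex_of_real (m / 4) * t * (complex_of_real a * z)" for a m t z
    by simp
  show ?thesis
  proof (intro ext)
    fix X x y
    have "pauli_diag2 \<mu> X y x = (\<Sum>i\<in>{1..4}. \<Sum>j\<in>{1..4}. complex_of_real (\<mu> i j / 4)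
        * trace (mmult (kron (pauli i) (pauli j)) X)
        * (complex_of_real ((if i = 4 then -1 else 1) * (if j = 4 then -1 else 1)) * kron (pauli i) (pauli j) x y))"
      unfolding pauli_diag2_def by (intro sum.cong refl arg_cong2[of _ _ _ _ "(*)"]) (simp add: k[of _ _ y x])
    then show "(transp \<circ> pauli_diag2 \<mu>) X x y
      = pauli_diag2 (\<lambda>i j. (if i = 4 then -1 else 1) * (if j = 4 then -1 else 1) * \<mu> i j) X x y"
      unfolding comp_def transp_def pauli_diag2_def[of "\<lambda>i j. _ i j * \<mu> i j"] c by simp
  qed
qed

text \<open>Transposition negates exactly the multiplier rows and columns of the antisymmetric
  matrix \<open>pauli 4\<close>. The reflection \<open>5 - r\<close> exchanges 1 with 4 and 2 with
  3, which is multiplication by 4 in the Klein four-group.\<close>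

lemma slack_pauli_ft:
  assumes "r \<in> {1..4}" "s \<in> {1..4}"
  shows "slack (pauli_ft \<mu>) r s =
    pauli_ft (\<lambda>i j. (if i = 4 then -1 else 1) * (if j = 4 then -1 else 1) * \<mu> i j) (5 - r) (5 - s)"
proof -
  have I: "{1..4} = {1,2,3,4::nat}" by auto
  let ?e = "\<lambda>r i. 2 * (if i = 1 then 1 else 0) - chr r i"
  have row: "(\<Sum>j\<in>{1..4}. pauli_ft \<mu> r j) = 4 * (\<Sum>i\<in>{1..4}. chr r i * \<mu> i 1)" for r
    unfolding pauli_ft_def sum_idx by (simp add: chr_def algebra_simps)
  have col: "(\<Sum>i\<in>{1..4}. pauli_ft \<mu> i s) = 4 * (\<Sum>j\<in>{1..4}. chr s j * \<mu> 1 j)" for s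
    unfolding pauli_ft_def sum_idx by (simp add: chr_def algebra_simps)
  have tot: "(\<Sum>i\<in>{1..4}. \<Sum>j\<in>{1..4}. pauli_ft \<mu> i j) = 16 * \<mu> 1 1"
    unfolding row unfolding sum_idx by (simp add: chr_def)
  \<comment> \<open>After the reflection, each tensor factor contributes twice the indicator of the
    index 1 minus the original character. Expanding the product of two such factors gives the four
    terms in the definition of \<open>slack\<close>.\<close>
  have e: "chr (5 - r) i * (if i = 4 then -1 else 1) = ?e r i" if "r \<in> {1..4}" "i \<in> {1..4}" for r i
    using that unfolding I by (elim insertE emptyE) (simp_all add: chr_def)
  have "pauli_ft (\<lambda>i j. (if i = 4 then -1 else 1) * (if j = 4 then -1 else 1) * \<mu> i j) (5 - r) (5 - s)
    = (\<Sum>i\<in>{1..4}. \<Sum>j\<in>{1..4}. (chr (5 - r) i * (if i = 4 then -1 else 1))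
        * (chr (5 - s) j * (if j = 4 then -1 else 1)) * \<mu> i j)"
    unfolding pauli_ft_def by (intro sum.cong refl) (simp only: ac_simps)
  also have "\<dots> = (\<Sum>i\<in>{1..4}. \<Sum>j\<in>{1..4}. ?e r i * ?e s j * \<mu> i j)"
    by (intro sum.cong refl) (simp only: e[OF assms(1)] e[OF assms(2)])
  also have "\<dots> = slack (pauli_ft \<mu>) r s"
    unfolding slack_def tot unfolding row col unfolding pauli_ft_def sum_idx
    by (simp add: chr_def[of _ 1] algebra_simps)
  finally show ?thesis ..
qed

lemma ppt_pauli_ft:
  assumes cp: "completely_positive (pauli_diag2 \<mu>)" and cc: "completely_copositive (pauli_diag2 \<mu>)"
  shows "ppt (pauli_ft \<mu>)"
proof -
  have "0 \<le> slack (pauli_ft \<mu>) r s" if rs: "r \<in> {1..4}" "s \<in> {1..4}" for r s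
    unfolding slack_pauli_ft[OF rs]
    using cc rs unfolding completely_copositive_def transp_pauli_diag2 by (intro pauli_ft_nonneg) auto
  then show ?thesis using pauli_ft_nonneg[OF cp] unfolding ppt_def by blast
qed

section \<open>Fourier inversion and composition\<close>

lemma pauli_ft_inverse:
  assumes "i \<in> {1..4}" "j \<in> {1..4}"
  shows "pauli_ft (pauli_ft \<mu>) i j = 16 * \<mu> i j"
proof -
  have I: "{1..4} = {1,2,3,4::nat}" by auto
  have inv: "(\<Sum>r\<in>{1..4}. chr i r * (\<Sum>k\<in>{1..4}. chr r k * f k)) = 4 * f i" if "i \<in> {1..4}" for f i
  proof -
    have "i \<in> {1,2,3,4}" using that unfolding I .
    then show ?thesis unfolding sum_idx by (elim insertE emptyE) (simp_all add: chr_def)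
  qed
  have "(\<Sum>s\<in>{1..4}. chr j s * (\<Sum>k\<in>{1..4}. chr r k * (\<Sum>l\<in>{1..4}. chr s l * \<mu> k l)))
      = (\<Sum>k\<in>{1..4}. chr r k * (\<Sum>s\<in>{1..4}. chr j s * (\<Sum>l\<in>{1..4}. chr s l * \<mu> k l)))" for r
    unfolding sum_distrib_left[of "chr j _"] sum_distrib_left[of "chr r _"]
    by (subst sum.swap) (simp only: mult.left_commute)
  then have "(\<Sum>r\<in>{1..4}. chr i r * (\<Sum>s\<in>{1..4}. chr j s * (\<Sum>k\<in>{1..4}. chr r k * (\<Sum>l\<in>{1..4}. chr s l * \<mu> k l))))
      = 4 * (4 * \<mu> i j)"
    by (simp only: inv[OF assms(1)] inv[OF assms(2)])
  moreover have ft: "pauli_ft p i j = (\<Sum>r\<in>{1..4}. chr i r * (\<Sum>s\<in>{1..4}. chr j s * p r s))" for p i j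
    unfolding pauli_ft_def sum_distrib_left by (simp only: mult.assoc)
  ultimately show ?thesis unfolding ft by simp
qed

lemma trace_pauli:
  assumes "i \<in> {1..4}" "j \<in> {1..4}" "k \<in> {1..4}" "l \<in> {1..4}"
  shows "trace (mmult (kron (pauli i) (pauli j)) (kron (pauli k) (pauli l))) = (if i = k \<and> j = l then 4 else 0)"
proof -
  have I: "{1..4} = {1,2,3,4::nat}" by auto
  have orth: "(\<Sum>a\<in>UNIV. \<Sum>b\<in>UNIV. pauli i a b * pauli k b a) = (if i = k then 2 else 0)"
    if "i \<in> {1..4}" "k \<in> {1..4}" for i k
    using that unfolding I UNIV_bool by (elim insertE emptyE) (simp_all add: pauli_def)
  have "trace (mmult (kron (pauli i) (pauli j)) (kron (pauli k) (pauli l)))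
    = (\<Sum>x\<in>UNIV. \<Sum>y\<in>UNIV. (pauli i (fst x) (fst y) * pauli k (fst y) (fst x)) * (pauli j (snd x) (snd y) * pauli l (snd y) (snd x)))"
    unfolding trace_def mmult_def kron_alt by (intro sum.cong refl) (simp only: ac_simps)
  also have "\<dots> = (\<Sum>x\<in>UNIV. (\<Sum>b\<in>UNIV. pauli i (fst x) b * pauli k b (fst x)) * (\<Sum>b\<in>UNIV. pauli j (snd x) b * pauli l b (snd x)))"
    by (intro sum.cong refl sum_pair_mult)
  also have "\<dots> = (\<Sum>a\<in>UNIV. \<Sum>b\<in>UNIV. pauli i a b * pauli k b a) * (\<Sum>a\<in>UNIV. \<Sum>b\<in>UNIV. pauli j a b * pauli l b a)"
    by (rule sum_pair_mult)
  finally show ?thesis using assms by (simp add: orth)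
qed

lemma trace_mmult_sum:
  fixes N :: "'k \<Rightarrow> 'k \<Rightarrow> ('i::finite) cmat"
  shows "trace (mmult A (\<lambda>x y. \<Sum>k\<in>S. \<Sum>l\<in>S. c k l * N k l x y)) = (\<Sum>k\<in>S. \<Sum>l\<in>S. c k l * trace (mmult A (N k l)))"
proof -
  have "trace (mmult A (\<lambda>x y. \<Sum>k\<in>S. \<Sum>l\<in>S. c k l * N k l x y))
    = (\<Sum>x\<in>UNIV. \<Sum>y\<in>UNIV. \<Sum>k\<in>S. \<Sum>l\<in>S. c k l * (A x y * N k l y x))"
    unfolding trace_def mmult_def sum_distrib_left by (intro sum.cong refl) (simp only: ac_simps)
  also have "\<dots> = (\<Sum>x\<in>UNIV. \<Sum>k\<in>S. \<Sum>l\<in>S. \<Sum>y\<in>UNIV. c k l * (A x y * N k l y x))"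
    by (intro sum.cong refl) (subst sum.swap, intro sum.cong refl, subst sum.swap, rule refl)
  also have "\<dots> = (\<Sum>k\<in>S. \<Sum>l\<in>S. \<Sum>x\<in>UNIV. \<Sum>y\<in>UNIV. c k l * (A x y * N k l y x))"
    by (subst sum.swap, intro sum.cong refl, subst sum.swap, rule refl)
  finally show ?thesis by (simp only: trace_def mmult_def sum_distrib_left)
qed

text \<open>By trace orthogonality the Pauli products are simultaneous eigenvectors of all these
  maps, with the multipliers as eigenvalues.\<close>

lemma pauli_diag2_comp:
  "pauli_diag2 \<mu> \<circ> pauli_diag2 \<nu> = pauli_diag2 (\<lambda>i j. \<mu> i j * \<nu> i j)"
proof
  fix X
  have t: "trace (mmult (kron (pauli i) (pauli j)) (pauli_diag2 \<nu> X)) = \<nu> i j * trace (mmult (kron (pauli i) (pauli j)) X)"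
    if ij: "i \<in> {1..4}" "j \<in> {1..4}" for i j
  proof -
    have "trace (mmult (kron (pauli i) (pauli j)) (pauli_diag2 \<nu> X))
      = (\<Sum>k\<in>{1..4}. \<Sum>l\<in>{1..4}. complex_of_real (\<nu> k l / 4) * trace (mmult (kron (pauli k) (pauli l)) X)
          * trace (mmult (kron (pauli i) (pauli j)) (kron (pauli k) (pauli l))))"
      unfolding pauli_diag2_def by (rule trace_mmult_sum)
    also have "\<dots> = (\<Sum>k\<in>{1..4}. \<Sum>l\<in>{1..4}. if j = l then if i = k then \<nu> k l * trace (mmult (kron (pauli k) (pauli l)) X) else 0 else 0)"
      by (intro sum.cong refl) (simp add: trace_pauli[OF ij])
    also have "\<dots> = \<nu> i j * trace (mmult (kron (pauli i) (pauli j)) X)"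
      using ij by simp
    finally show ?thesis .
  qed
  show "(pauli_diag2 \<mu> \<circ> pauli_diag2 \<nu>) X = pauli_diag2 (\<lambda>i j. \<mu> i j * \<nu> i j) X"
    unfolding comp_def pauli_diag2_def[of \<mu>] pauli_diag2_def[of "\<lambda>i j. \<mu> i j * \<nu> i j"]
    by (intro ext sum.cong refl) (simp add: t)
qed

section \<open>Separability\<close>

lemma separable_add:
  assumes "separable M" "separable N"
  shows "separable (\<lambda>x y. M x y + N x y)"
proof -
  obtain n :: nat and A B where M: "\<forall>k<n. psd (A k) \<and> psd (B k)" "M = (\<lambda>x y. \<Sum>k<n. kron (A k) (B k) x y)"
    using assms(1) unfolding separable_def by (elim exE conjE) (rule that; assumption)
  obtain m :: nat and A' B' where N: "\<forall>k<m. psd (A' k) \<and> psd (B' k)" "N = (\<lambda>x y. \<Sum>k<m. kron (A' k) (B' k) x y)"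
    using assms(2) unfolding separable_def by (elim exE conjE) (rule that; assumption)
  define C where "C = (\<lambda>k. if k < n then A k else A' (k - n))"
  define D where "D = (\<lambda>k. if k < n then B k else B' (k - n))"
  have split: "(\<Sum>k<n + m. g k) = (\<Sum>k<n. g k) + (\<Sum>k<m. g (n + k))" for g :: "nat \<Rightarrow> complex"
    by (induction m) (simp_all add: add.assoc)
  have "(\<Sum>k<n + m. kron (C k) (D k) x y) = M x y + N x y" for x y
    unfolding split M(2) N(2) by (simp add: C_def D_def)
  moreover have "\<forall>k<n + m. psd (C k) \<and> psd (D k)"
    using M(1) N(1) by (simp add: C_def D_def)
  ultimately show ?thesis unfolding separable_def by (intro exI[of _ "n + m"] exI[of _ C] exI[of _ D]) simp
qed

lemma psd_scale:
  assumes "psd A" "0 \<le> c"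
  shows "psd (\<lambda>x y. complex_of_real c * A x y)"
  unfolding psd_def
proof
  fix v
  have "(\<Sum>a\<in>UNIV. \<Sum>b\<in>UNIV. cnj (v a) * (complex_of_real c * A a b) * v b)
    = complex_of_real c * (\<Sum>a\<in>UNIV. \<Sum>b\<in>UNIV. cnj (v a) * A a b * v b)"
    unfolding sum_distrib_left by (intro sum.cong refl) (simp only: ac_simps)
  then show "cnonneg (\<Sum>a\<in>UNIV. \<Sum>b\<in>UNIV. cnj (v a) * (complex_of_real c * A a b) * v b)"
    using assms unfolding psd_def cnonneg_def by simp
qed

lemma separable_scale:
  assumes "separable M" "0 \<le> c"
  shows "separable (\<lambda>x y. complex_of_real c * M x y)"
proof -
  obtain n :: nat and A B where M: "\<forall>k<n. psd (A k) \<and> psd (B k)" "M = (\<lambda>x y. \<Sum>k<n. kron (A k) (B k) x y)"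
    using assms(1) unfolding separable_def by (elim exE conjE) (rule that; assumption)
  show ?thesis
    unfolding separable_def
  proof (intro exI conjI)
    show "\<forall>k<n. psd (\<lambda>x y. complex_of_real c * A k x y) \<and> psd (B k)"
      using M(1) psd_scale assms(2) by blast
    show "(\<lambda>x y. complex_of_real c * M x y) = (\<lambda>x y. \<Sum>k<n. kron (\<lambda>x y. complex_of_real c * A k x y) (B k) x y)"
      unfolding M(2) by (simp add: kron_alt sum_distrib_left mult.assoc)
  qed
qed

lemma separable_kron:
  assumes "psd A" "psd B"
  shows "separable (kron A B)"
  unfolding separable_def
  by (intro exI[of _ 1] exI[of _ "\<lambda>_. A"] exI[of _ "\<lambda>_. B"]) (simp add: assms)

lemma psd_transp:
  assumes "psd A" shows "psd (transp A)"
  unfolding psd_def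
proof
  fix v
  have "(\<Sum>a\<in>UNIV. \<Sum>b\<in>UNIV. cnj (v a) * transp A a b * v b) = (\<Sum>a\<in>UNIV. \<Sum>b\<in>UNIV. cnj (cnj (v a)) * A a b * cnj (v b))"
    by (subst sum.swap) (simp add: transp_def mult.commute mult.left_commute)
  then show "cnonneg (\<Sum>a\<in>UNIV. \<Sum>b\<in>UNIV. cnj (v a) * transp A a b * v b)"
    using assms[unfolded psd_def, rule_format, of "\<lambda>a. cnj (v a)"] by simp
qed

section \<open>Joint eigenprojections of commuting Pauli matrices\<close>

lemma cnonneg_sum: "(\<And>z. z \<in> A \<Longrightarrow> cnonneg (f z)) \<Longrightarrow> cnonneg (\<Sum>z\<in>A. f z)"
  by (simp add: cnonneg_def sum_nonneg)

text \<open>From \<open>M\<close> Hermitian with square \<open>c * M\<close>, the form of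
  \<open>M\<close> at \<open>v\<close> multiplied by \<open>c\<close> is the squared norm of
  \<open>M\<close> applied to \<open>v\<close>.\<close>

lemma psd_projection:
  assumes herm: "\<And>x y. M y x = cnj (M x y)"
    and sq: "\<And>x y. (\<Sum>z\<in>UNIV. M x z * M z y) = complex_of_real c * M x y" and c: "0 < c"
  shows "psd M"
  unfolding psd_def
proof
  fix v
  let ?w = "\<lambda>z. \<Sum>y\<in>UNIV. M z y * v y"
  have term_eq: "cnj (v x) * (M x z * M z y) * v y = cnj (M z x * v x) * (M z y * v y)" for x y z
    by (simp add: herm[of x z])
  have "complex_of_real c * (\<Sum>x\<in>UNIV. \<Sum>y\<in>UNIV. cnj (v x) * M x y * v y)
    = (\<Sum>x\<in>UNIV. \<Sum>y\<in>UNIV. cnj (v x) * (complex_of_real c * M x y) * v y)"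
    unfolding sum_distrib_left by (intro sum.cong refl) (simp only: ac_simps)
  also have "\<dots> = (\<Sum>x\<in>UNIV. \<Sum>y\<in>UNIV. \<Sum>z\<in>UNIV. cnj (M z x * v x) * (M z y * v y))"
    unfolding sq[symmetric] sum_distrib_left sum_distrib_right
    by (intro sum.cong refl term_eq)
  also have "\<dots> = (\<Sum>z\<in>UNIV. \<Sum>x\<in>UNIV. \<Sum>y\<in>UNIV. cnj (M z x * v x) * (M z y * v y))"
    by (rule trans[OF sum.cong[OF refl sum.swap] sum.swap])
  also have "\<dots> = (\<Sum>z\<in>UNIV. cnj (?w z) * ?w z)"
    by (simp only: sum_product cnj_sum)
  finally have "complex_of_real c * (\<Sum>x\<in>UNIV. \<Sum>y\<in>UNIV. cnj (v x) * M x y * v y) = (\<Sum>z\<in>UNIV. cnj (?w z) * ?w z)" .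
  moreover have "cnonneg (\<Sum>z\<in>UNIV. cnj (?w z) * ?w z)"
    by (intro cnonneg_sum cnonneg_norm)
  ultimately have "cnonneg (complex_of_real c * (\<Sum>x\<in>UNIV. \<Sum>y\<in>UNIV. cnj (v x) * M x y * v y))" by simp
  then show "cnonneg (\<Sum>x\<in>UNIV. \<Sum>y\<in>UNIV. cnj (v x) * M x y * v y)"
    using c by (simp add: cnonneg_def zero_le_mult_iff)
qed

text \<open>If \<open>E\<close> is the identity, \<open>A\<close> and \<open>B\<close> are commuting
  Hermitian involutions and \<open>A B = k C\<close>, this is the product of \<open>E + s A\<close>
  and \<open>E + t B\<close>, hence four times the projection onto the joint eigenspace with
  eigenvalues \<open>s\<close> and \<open>t\<close>.\<close>

definition joint :: "'i cmat \<Rightarrow> 'i cmat \<Rightarrow> 'i cmat \<Rightarrow> 'i cmat \<Rightarrow> real \<Rightarrow> real \<Rightarrow> real \<Rightarrow> 'i cmat" where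
  "joint E A B C k s t = (\<lambda>x y. E x y + of_real s * A x y + of_real t * B x y + of_real (k * s * t) * C x y)"

text \<open>Averaging the products of projections over the four sign pairs cancels all cross terms.
  Shifting the signs in the second factor by \<open>e\<close> and \<open>d\<close> produces the
  coefficients, and \<open>k\<close> enters only through its square.\<close>

lemma separable_joint:
  assumes psd: "\<And>s t. s \<in> {1,-1} \<Longrightarrow> t \<in> {1,-1} \<Longrightarrow> psd (joint E A B C k s t)"
    and k: "k \<in> {1,-1}" and e: "e \<in> {1,-1}" and d: "d \<in> {1,-1}"
  shows "separable (\<lambda>x y. kron (transp E) E x y + of_real e * kron (transp A) A x y
    + of_real d * kron (transp B) B x y + of_real (e * d) * kron (transp C) C x y)"
proof -
  let ?K = "\<lambda>s t. kron (transp (joint E A B C k s t)) (joint E A B C k (e * s) (d * t))"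
  have sep: "separable (?K s t)" if "s \<in> {1,-1}" "t \<in> {1,-1}" for s t
    using that e d by (intro separable_kron psd_transp psd sign_mult)
  have "separable (\<lambda>x y. complex_of_real (1/4) * (?K 1 1 x y + ?K 1 (-1) x y + ?K (-1) 1 x y + ?K (-1) (-1) x y))"
    by (intro separable_scale separable_add sep) simp_all
  moreover have "complex_of_real (1/4) * (?K 1 1 x y + ?K 1 (-1) x y + ?K (-1) 1 x y + ?K (-1) (-1) x y)
    = kron (transp E) E x y + of_real e * kron (transp A) A x y
    + of_real d * kron (transp B) B x y + of_real (e * d) * kron (transp C) C x y" for x y
    using k by (elim insertE emptyE) (simp_all add: kron_alt joint_def transp_def algebra_simps)
  ultimately show ?thesis by (simp only:)
qed

lemma mmult_linear:
  "mmult (\<lambda>x y. A x y + B x y) C x y = mmult A C x y + mmult B C x y"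
  "mmult A (\<lambda>x y. B x y + C x y) x y = mmult A B x y + mmult A C x y"
  "mmult (\<lambda>x y. c * A x y) B x y = c * mmult A B x y"
  "mmult A (\<lambda>x y. c * B x y) x y = c * mmult A B x y"
  by (simp_all add: mmult_def sum.distrib sum_distrib_left algebra_simps)

lemma mmult_kron: "mmult (kron A B) (kron C D) = kron (mmult A C) (mmult B D)"
  by (intro ext) (simp add: mmult_def kron_alt sum_pair_mult[symmetric] mult.assoc mult.left_commute)

lemma kron_scale:
  "kron (\<lambda>x y. c * A x y) B x y = c * kron A B x y"
  "kron A (\<lambda>x y. c * B x y) x y = c * kron A B x y"
  by (simp_all add: kron_alt)

lemma pauli_mult:
  "mmult (pauli 1) (pauli 1) = pauli 1" "mmult (pauli 1) (pauli 2) = pauli 2"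
  "mmult (pauli 1) (pauli 3) = pauli 3" "mmult (pauli 1) (pauli 4) = pauli 4"
  "mmult (pauli 2) (pauli 1) = pauli 2" "mmult (pauli 2) (pauli 2) = pauli 1"
  "mmult (pauli 3) (pauli 1) = pauli 3" "mmult (pauli 3) (pauli 3) = pauli 1"
  "mmult (pauli 4) (pauli 1) = pauli 4" "mmult (pauli 4) (pauli 4) = pauli 1"
  "mmult (pauli 2) (pauli 3) = (\<lambda>x y. - \<i> * pauli 4 x y)" "mmult (pauli 3) (pauli 2) = (\<lambda>x y. \<i> * pauli 4 x y)"
  "mmult (pauli 2) (pauli 4) = (\<lambda>x y. \<i> * pauli 3 x y)" "mmult (pauli 4) (pauli 2) = (\<lambda>x y. - \<i> * pauli 3 x y)"
  "mmult (pauli 3) (pauli 4) = (\<lambda>x y. - \<i> * pauli 2 x y)" "mmult (pauli 4) (pauli 3) = (\<lambda>x y. \<i> * pauli 2 x y)"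
  by (intro ext; simp add: mmult_def UNIV_bool pauli_def)+

lemma joint_pauli_hermitian:
  "joint (kron (pauli a) (pauli b)) (kron (pauli c) (pauli d)) (kron (pauli e) (pauli f)) (kron (pauli g) (pauli h)) k s t y x
    = cnj (joint (kron (pauli a) (pauli b)) (kron (pauli c) (pauli d)) (kron (pauli e) (pauli f)) (kron (pauli g) (pauli h)) k s t x y)"
proof -
  have p: "pauli i y x = cnj (pauli i x y)" for i x y by (auto simp: pauli_def)
  have "kron (pauli i) (pauli j) y x = cnj (kron (pauli i) (pauli j) x y)" for i j
    unfolding kron_alt p[of _ "fst y"] p[of _ "snd y"] by simp
  then show ?thesis unfolding joint_def by simp
qed

lemma psd_joint_pauli:
  assumes "\<And>x y. mmult (joint (kron (pauli a) (pauli b)) (kron (pauli c) (pauli d)) (kron (pauli e) (pauli f)) (kron (pauli g) (pauli h)) k s t)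
      (joint (kron (pauli a) (pauli b)) (kron (pauli c) (pauli d)) (kron (pauli e) (pauli f)) (kron (pauli g) (pauli h)) k s t) x y
    = 4 * joint (kron (pauli a) (pauli b)) (kron (pauli c) (pauli d)) (kron (pauli e) (pauli f)) (kron (pauli g) (pauli h)) k s t x y"
  shows "psd (joint (kron (pauli a) (pauli b)) (kron (pauli c) (pauli d)) (kron (pauli e) (pauli f)) (kron (pauli g) (pauli h)) k s t)"
  by (rule psd_projection[where c = 4], rule joint_pauli_hermitian)
    (use assms in \<open>simp_all add: mmult_def\<close>)

lemma psd_joint_blk:
  assumes "a \<in> {2,3,4}" "b \<in> {2,3,4}" "s \<in> {1,-1}" "t \<in> {1,-1}"
  shows "psd (joint (kron (pauli 1) (pauli 1)) (kron (pauli a) (pauli 1)) (kron (pauli 1) (pauli b)) (kron (pauli a) (pauli b)) 1 s t)"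
proof (rule psd_joint_pauli)
  fix x y
  let ?M = "joint (kron (pauli 1) (pauli 1)) (kron (pauli a) (pauli 1)) (kron (pauli 1) (pauli b)) (kron (pauli a) (pauli b)) 1 s t"
  show "mmult ?M ?M x y = 4 * ?M x y"
    using assms unfolding joint_def mmult_linear mmult_kron
    by (elim insertE emptyE; simp only: pauli_mult kron_scale; simp add: algebra_simps)
qed

lemma enum_perms:
  assumes "{w1,w2,w3} = {2,3,4::nat}"
  shows "(w1,w2,w3) \<in> {(2,3,4),(3,4,2),(4,2,3),(2,4,3),(3,2,4),(4,3,2)}"
proof -
  have "w1 \<in> {2,3,4}" "w2 \<in> {2,3,4}" "w3 \<in> {2,3,4}" unfolding assms[symmetric] by simp_all
  then show ?thesis using enum_distinct(4-6)[OF enum_one[OF assms]] by (elim insertE emptyE; simp)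
qed

lemma psd_joint_prm:
  assumes U: "{u1,u2,u3} = {2,3,4}" and W: "{w1,w2,w3} = {2,3,4}"
  obtains k where "k \<in> {1,-1}"
    "\<forall>s\<in>{1,-1}. \<forall>t\<in>{1,-1}.
      psd (joint (kron (pauli 1) (pauli 1)) (kron (pauli u1) (pauli w1)) (kron (pauli u2) (pauli w2)) (kron (pauli u3) (pauli w3)) k s t)"
proof -
  let ?even = "\<lambda>x. x \<in> {(2,3,4),(3,4,2),(4,2,3::nat)}"
  \<comment> \<open>Two distinct nonidentity Pauli matrices multiply to the third with phase
    \<open>- \<i>\<close> in the cyclic order 2, 3, 4 and \<open>\<i>\<close> in the reverse order.
    The two tensor factors together give -1 for equal parities and 1 for opposite ones.\<close>
  define k :: real where "k = (if ?even (u1,u2,u3) = ?even (w1,w2,w3) then -1 else 1)"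
  let ?M = "joint (kron (pauli 1) (pauli 1)) (kron (pauli u1) (pauli w1)) (kron (pauli u2) (pauli w2)) (kron (pauli u3) (pauli w3)) k"
  have "psd (?M s t)" if st: "s \<in> {1,-1}" "t \<in> {1,-1}" for s t
  proof (rule psd_joint_pauli)
    fix x y
    show "mmult (?M s t) (?M s t) x y = 4 * ?M s t x y"
      using st enum_perms[OF U] enum_perms[OF W] unfolding joint_def mmult_linear mmult_kron k_def
      by (elim insertE emptyE Pair_inject; simp only: pauli_mult kron_scale; simp add: algebra_simps)
  qed
  moreover have "k \<in> {1,-1}" by (simp add: k_def)
  ultimately show thesis using that by blast
qed

lemma stab_separable: "stab \<mu> \<Longrightarrow> separable (choi (pauli_diag2 \<mu>))"
proof (induction rule: stab.induct)
  case (blk a b e d)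
  let ?K = "\<lambda>i j. kron (transp (kron (pauli i) (pauli j))) (kron (pauli i) (pauli j))"
  have "separable (\<lambda>x y. ?K 1 1 x y + of_real e * ?K a 1 x y + of_real d * ?K 1 b x y + of_real (e * d) * ?K a b x y)"
    using blk by (intro separable_joint[where k = 1] psd_joint_blk) simp_all
  then have "separable (\<lambda>x y. complex_of_real (1/4) *
      (?K 1 1 x y + of_real e * ?K a 1 x y + of_real d * ?K 1 b x y + of_real (e * d) * ?K a b x y))"
    by (rule separable_scale) simp
  moreover have "choi (pauli_diag2 (blk a e b d)) x y = complex_of_real (1/4) *
      (?K 1 1 x y + of_real e * ?K a 1 x y + of_real d * ?K 1 b x y + of_real (e * d) * ?K a b x y)" for x y
    using blk(1,2) unfolding choi_pauli_diag2 sum_idx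
    by (elim insertE emptyE; simp add: blk_def field_simps)
  ultimately show ?case by (simp only:)
next
  case (prm u1 u2 u3 w1 w2 w3 e d)
  let ?K = "\<lambda>i j. kron (transp (kron (pauli i) (pauli j))) (kron (pauli i) (pauli j))"
  obtain k where k: "k \<in> {1,-1}"
    "\<forall>s\<in>{1,-1}. \<forall>t\<in>{1,-1}.
      psd (joint (kron (pauli 1) (pauli 1)) (kron (pauli u1) (pauli w1)) (kron (pauli u2) (pauli w2)) (kron (pauli u3) (pauli w3)) k s t)"
    by (rule psd_joint_prm[OF prm(1,2)])
  have "separable (\<lambda>x y. ?K 1 1 x y + of_real e * ?K u1 w1 x y + of_real d * ?K u2 w2 x y + of_real (e * d) * ?K u3 w3 x y)"
    by (rule separable_joint[OF k(2)[rule_format] k(1) prm(3,4)])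
  then have "separable (\<lambda>x y. complex_of_real (1/4) *
      (?K 1 1 x y + of_real e * ?K u1 w1 x y + of_real d * ?K u2 w2 x y + of_real (e * d) * ?K u3 w3 x y))"
    by (rule separable_scale) simp
  moreover have "choi (pauli_diag2 (prm u1 w1 e u2 w2 d u3 w3)) x y = complex_of_real (1/4) *
      (?K 1 1 x y + of_real e * ?K u1 w1 x y + of_real d * ?K u2 w2 x y + of_real (e * d) * ?K u3 w3 x y)" for x y
    unfolding choi_pauli_diag2 sum_enum[OF enum_one[OF prm(1)], of "\<lambda>i. \<Sum>j\<in>{1..4}. _ i j"]
    unfolding sum_enum[OF enum_one[OF prm(2)]]
    using enum_distinct[OF enum_one[OF prm(1)]] enum_distinct[OF enum_one[OF prm(2)]]
    by (simp add: prm_def algebra_simps)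
  ultimately show ?case by (simp only:)
next
  case (add \<mu> \<nu>)
  have "choi (pauli_diag2 (\<lambda>i j. \<mu> i j + \<nu> i j)) x y = choi (pauli_diag2 \<mu>) x y + choi (pauli_diag2 \<nu>) x y" for x y
    unfolding choi_pauli_diag2 sum.distrib[symmetric] by (intro sum.cong refl) (simp add: field_simps)
  then show ?case using separable_add[OF add.IH] by (simp only:)
next
  case (scale \<mu> c)
  have "choi (pauli_diag2 (\<lambda>i j. c * \<mu> i j)) x y = complex_of_real c * choi (pauli_diag2 \<mu>) x y" for x y
    unfolding choi_pauli_diag2 sum_distrib_left by (intro sum.cong refl) simp
  then show ?case using separable_scale[OF scale.IH scale.hyps(2)] by (simp only:)
next
  case (cong \<mu> \<nu>)
  have "choi (pauli_diag2 \<nu>) = choi (pauli_diag2 \<mu>)"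
    unfolding choi_pauli_diag2 fun_eq_iff using cong.hyps(2) by (intro allI sum.cong refl) simp
  then show ?case using cong.IH by simp
qed

theorem mainTheorem12:
  fixes \<mu>1 \<mu>2 :: "nat \<Rightarrow> nat \<Rightarrow> real"
  assumes "completely_positive (pauli_diag2 \<mu>1)"
      and "completely_copositive (pauli_diag2 \<mu>1)"
      and "completely_positive (pauli_diag2 \<mu>2)"
      and "completely_copositive (pauli_diag2 \<mu>2)"
  shows "entanglement_breaking (pauli_diag2 \<mu>1 \<circ> pauli_diag2 \<mu>2)"
proof -
  \<comment> \<open>Applying \<open>pauli_ft\<close> twice multiplies by 16, once for each of the
    two factors, and \<open>1 / 256\<close> undoes both.\<close>
  have "stab (\<lambda>i j. 1 / 256 * (pauli_ft (pauli_ft \<mu>1) i j * pauli_ft (pauli_ft \<mu>2) i j))"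
    using assms by (intro stab.scale stab_mult ppt_pauli_ft) simp_all
  then have "stab (\<lambda>i j. \<mu>1 i j * \<mu>2 i j)"
    by (rule stab.cong) (simp add: pauli_ft_inverse)
  then show ?thesis
    unfolding entanglement_breaking_def pauli_diag2_comp by (rule stab_separable)
qed

end
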